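(* Let $\mathbf{w}_k$, $k\ge 0$, be the iterates of the distributed SGD algorithm $$\mathbf{w}_{k+1}=(\mathcal{W}_k\otimes I_{d_w})\,\mathbf{w}_k-\alpha_k\,\mathbf{g}(\mathbf{w}_k,\bm{\xi}_k),\qquad \mathcal{W}_k=I_n-\beta_k\mathcal{L},$$ and suppose that assumptions (A1)-(A8) of the context hold. Let $\overline{\nabla F}(\mathbf{w})=\frac1n(\mathbf{1}_n\mathbf{1}_n^\top\otimes I_{d_w})\nabla F(\mathbf{w})$. Then $$\lim_{k\to\infty}\mathbb{E}\left[\left\|\overline{\nabla F}(\mathbf{w}_k)\right\|_2^2\right]=0.$$
   Context: Setting. There are $n$ agents; agent $i$ has a local objective $f_i:\mathbb{R}^{d_w}\to\mathbb{R}$, $f_i(\bm{w})=\frac1{m_i}\sum_{j=1}^{m_i}\ell(\bm{w},\bm{\xi}_i^j)$, where $\bm{\xi}_i^1,\dots,\bm{\xi}_i^{m_i}$ are its data samples and $\ell$ is a loss function. Agents communicate over a graph $\mathcal{G}$ on $n$ nodes with 0/1 adjacency matrix $\mathcal{A}=[a_{ij}]$ and Laplacian $\mathcal{L}=\mathrm{diag}(\mathcal{A}\mathbf{1}_n)-\mathcal{A}$, where $\mathbf{1}_n$ is the all-ones vector. From an arbitrary initial condition $\bm{w}_i(0)\in\mathbb{R}^{d_w}$, agent $i$ updates $$\bm{w}_i(k+1)=\bm{w}_i(k)-\beta_k\sum_{j=1}^n a_{ij}(\bm{w}_i(k)-\bm{w}_j(k))-\alpha_k\,\mathbf{g}_i(\bm{w}_i(k),\bm{\xi}_i(k)),$$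 where $\mathbf{g}_i(\bm{w}_i(k),\bm{\xi}_i(k))\in\mathbb{R}^{d_w}$ is a random stochastic gradient direction (a single-sample gradient of $\ell$, a mini-batch average of such gradients, or such an average multiplied by a positive definite matrix $H_i(k)$) built from the random sample(s) $\bm{\xi}_i(k)$ drawn at time $k$. The probabilistic properties assumed of it are (A6) and (A7). Stacking, $\mathbf{w}_k=\mathbf{w}(k)=[\bm{w}_1(k)^\top\cdots\bm{w}_n(k)^\top]^\top\in\mathbb{R}^{nd_w}$ and $\mathbf{g}(\mathbf{w}_k,\bm{\xi}_k)=[\mathbf{g}_1(\bm{w}_1(k),\bm{\xi}_1(k))^\top\cdots\mathbf{g}_n(\bm{w}_n(k),\bm{\xi}_n(k))^\top]^\top$, which gives the iteration in the claim. Aggregate objective: for $\mathbf{w}=[\bm{w}_1^\top\cdots\bm{w}_n^\top]^\top$, $F(\mathbf{w})=\sum_{i=1}^n f_i(\bm{w}_i)$, so $\nabla F(\mathbf{w})=[\nabla f_1(\bm{w}_1)^\top\cdots\nabla f_n(\bm{w}_n)^\top]^\top$. $\mathbb{E}_\xi[\cdot]=\mathbb{E}[\cdot\,|\,\mathcal{F}_k]$, where $\mathcal{F}_k$ is the $\sigma$-algebra generated by $\mathbf{w}_0,\dots,\mathbf{w}_k$. $\otimes$ is the Kronecker product. Assumptions. (A1) For each $i$, $f_i$ is differentiable and there are $L_i^0,L_i>0$ with $|f_i(\bm{w}_a)-f_i(\bm{w}_b)|\le L_i^0\|\bm{w}_a-\bm{w}_b\|_2$ and $\|\nabla f_i(\bm{w}_a)-\nabla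 f_i(\bm{w}_b)\|_2\le L_i\|\bm{w}_a-\bm{w}_b\|_2$ for all $\bm{w}_a,\bm{w}_b\in\mathbb{R}^{d_w}$. (A2) $F$ is bounded below: there is $F_{\inf}\in\mathbb{R}$ with $F_{\inf}\le F(\mathbf{w})$ for all $\mathbf{w}\in\mathbb{R}^{nd_w}$. (A3) $\alpha_k=\frac{a}{(k+1)^{\delta_2}}$, $\beta_k=\frac{b}{(k+1)^{\delta_1}}$, with $a>0$, $b>0$, $0<3\delta_1<\delta_2\le1$, $\delta_1+\delta_2>1$, $\delta_2>1/2$. (A4) $\mathcal{G}$ is a connected undirected graph. (A5) $b$ is such that $\mathcal{W}_0=I_n-b\mathcal{L}$ has a single eigenvalue at $1$, with right eigenvector $\mathbf{1}_n$, and its remaining $n-1$ eigenvalues are strictly inside the unit circle; moreover $b\,\sigma_{\max}(\mathcal{L})<1$, where $\sigma_{\max}$ is the largest singular value. (A6) $\mathbb{E}_\xi[\mathbf{g}(\mathbf{w}_k,\bm{\xi}_k)]=\nabla F(\mathbf{w}_k)$ almost surely, for all $k\ge0$. (A7) There are scalars $\bar\mu_{v_1},\bar\mu_{v_2}\ge0$ with $\mathbb{E}_\xi[\|\mathbf{g}(\mathbf{w}_k,\bm{\xi}_k)\|_2^2]\le\bar\mu_{v_1}+\bar\mu_{v_2}\|\nabla F(\mathbf{w}_k)\|_2^2$ almost surely, for all $k\ge0$. (A8) Each $f_i$ is twice continuously differentiable and there are constants $L_{H_i}$ with $\|\nabla^2 f_i(\bm{w}_a)-\nabla^2 f_i(\bm{w}_b)\|_2\le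 L_{H_i}\|\bm{w}_a-\bm{w}_b\|_2$ for all $\bm{w}_a,\bm{w}_b\in\mathbb{R}^{d_w}$. *)

theory Defs
  imports
    "HOL-Probability.Probability"
    "HOL-Computational_Algebra.Polynomial"
    "Graph_Theory.Pair_Digraph"
    "Graph_Theory.Digraph_Component"
begin

section \<open>Matrices\<close>

definition eigenvalue :: "'a::field^'n^'n \<Rightarrow> 'a \<Rightarrow> bool" where
  "eigenvalue A z \<longleftrightarrow> (\<exists>v. v \<noteq> 0 \<and> A *v v = z *s v)"

definition charpoly :: "'a::comm_ring_1^'n^'n \<Rightarrow> 'a poly" where
  "charpoly A = det (\<chi> i j. (if i = j then [:0, 1:] else 0) - [:A $ i $ j:])"

definition alg_multiplicity :: "'a::field^'n^'n \<Rightarrow> 'a \<Rightarrow> nat" where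
  "alg_multiplicity A z = order z (charpoly A)"

definition complex_matrix :: "real^'n^'m \<Rightarrow> complex^'n^'m" where
  "complex_matrix A = (\<chi> i j. complex_of_real (A $ i $ j))"

definition singular_values :: "real^'n^'m \<Rightarrow> real set" where
  "singular_values A = {sqrt s | s. eigenvalue (transpose A ** A) s}"

definition sigma_max :: "real^'n^'m \<Rightarrow> real" where
  "sigma_max A = Max (singular_values A)"

definition matrix_norm2 :: "real^'n^'m \<Rightarrow> real" where
  "matrix_norm2 A = onorm ((*v) A)"

definition kronecker :: "real^'n^'m \<Rightarrow> real^'q^'p \<Rightarrow> real^('n::finite \<times> 'q::finite)^('m::finite \<times> 'p::finite)" where
  "kronecker A B = (\<chi> r c. A $ fst r $ fst c * B $ snd r $ snd c)"

section \<open>Stacked vectors\<close>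

text \<open>A vector of dimension \<open>n * d\<close> is indexed by pairs (agent, coordinate).\<close>

definition block :: "real^('n::finite \<times> 'd::finite) \<Rightarrow> 'n \<Rightarrow> real^'d" where
  "block w i = (\<chi> c. w $ (i, c))"

definition stack :: "('n \<Rightarrow> real^'d) \<Rightarrow> real^('n::finite \<times> 'd::finite)" where
  "stack v = (\<chi> p. v (fst p) $ snd p)"

section \<open>Gradient and Hessian\<close>

text \<open>Both are only meaningful at points where the derivatives involved exist.\<close>

definition grad :: "('a::real_inner \<Rightarrow> real) \<Rightarrow> 'a \<Rightarrow> 'a" where
  "grad f x = (THE D. GDERIV f x :> D)"

definition hessian :: "(real^'d \<Rightarrow> real) \<Rightarrow> real^'d \<Rightarrow> real^'d^'d" where
  "hessian f x = matrix (frechet_derivative (grad f) (at x))"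

definition twice_cont_differentiable :: "(real^'d \<Rightarrow> real) \<Rightarrow> bool" where
  "twice_cont_differentiable f \<longleftrightarrow>
     (\<forall>x. f differentiable (at x)) \<and> (\<forall>x. grad f differentiable (at x)) \<and>
     continuous_on UNIV (hessian f)"

section \<open>Graphs\<close>

definition adjacency_matrix :: "'n pair_pre_digraph \<Rightarrow> real^'n^'n" where
  "adjacency_matrix G = (\<chi> i j. if (i, j) \<in> parcs G then 1 else 0)"

definition diag_matrix :: "real^'n \<Rightarrow> real^'n^'n" where
  "diag_matrix v = (\<chi> i j. if i = j then v $ i else 0)"

text \<open>Here \<open>1 :: real^'n\<close> is the all-ones vector.\<close>

definition laplacian :: "'n pair_pre_digraph \<Rightarrow> real^'n^'n" where
  "laplacian G = diag_matrix (adjacency_matrix G *v 1) - adjacency_matrix G"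

definition mixing_matrix :: "'n pair_pre_digraph \<Rightarrow> real \<Rightarrow> real^'n^'n" where
  "mixing_matrix G \<beta> = mat 1 - \<beta> *\<^sub>R laplacian G"

section \<open>Objectives\<close>

definition local_objective ::
    "(real^'d \<Rightarrow> 'x \<Rightarrow> real) \<Rightarrow> ('n \<Rightarrow> nat) \<Rightarrow> ('n \<Rightarrow> nat \<Rightarrow> 'x) \<Rightarrow> 'n \<Rightarrow> real^'d \<Rightarrow> real" where
  "local_objective loss m data i x = 1 / real (m i) * (\<Sum>j = 1..m i. loss x (data i j))"

definition aggregate :: "('n \<Rightarrow> real^'d \<Rightarrow> real) \<Rightarrow> real^('n::finite \<times> 'd::finite) \<Rightarrow> real" where
  "aggregate f w = (\<Sum>i\<in>UNIV. f i (block w i))"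

definition avg_grad :: "('n \<Rightarrow> real^'d \<Rightarrow> real) \<Rightarrow> real^('n::finite \<times> 'd::finite) \<Rightarrow> real^('n::finite \<times> 'd::finite)" where
  "avg_grad f w =
     (1 / real CARD('n)) *\<^sub>R
       (kronecker ((\<chi> i j. 1) :: real^'n^'n) (mat 1 :: real^'d^'d) *v grad (aggregate f) w)"

section \<open>Stochastic notions\<close>

definition history_algebra :: "'w measure \<Rightarrow> (nat \<Rightarrow> 'w \<Rightarrow> 'b::topological_space) \<Rightarrow> nat \<Rightarrow> 'w measure" where
  "history_algebra M w k =
     sigma (space M) (\<Union>i\<le>k. {w i -` B \<inter> space M | B. B \<in> sets borel})"

definition vec_cond_exp :: "'w measure \<Rightarrow> 'w measure \<Rightarrow> ('w \<Rightarrow> real^'b) \<Rightarrow> 'w \<Rightarrow> real^'b" where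
  "vec_cond_exp M A X \<omega> = (\<chi> c. real_cond_exp M A (\<lambda>\<omega>'. X \<omega>' $ c) \<omega>)"

text \<open>
  The direction of agent \<open>i\<close> at time \<open>k\<close> is a function \<open>g k i\<close> of its iterate and of what it
  draws at time \<open>k\<close>. The drawn object \<open>y i\<close> may be a single sample or a whole mini-batch, and
  the dependence of \<open>g\<close> on \<open>k\<close> accommodates time-varying preconditioners.
\<close>

definition stacked_direction ::
    "(nat \<Rightarrow> 'n \<Rightarrow> real^'d \<Rightarrow> 'y \<Rightarrow> real^'d) \<Rightarrow> nat \<Rightarrow> real^('n::finite \<times> 'd::finite) \<Rightarrow> ('n \<Rightarrow> 'y) \<Rightarrow> real^('n::finite \<times> 'd::finite)" where
  "stacked_direction g k x y = stack (\<lambda>i. g k i (block x i) (y i))"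

end

theory Submission
  imports Defs
begin

text \<open>
  Let \<open>P\<close> be the orthogonal projection of the stacked space onto the consensus subspace, so that
  \<open>P w\<close> replaces every agent's block by the average of all blocks and the quantity of the theorem is
  \<open>P (\<nabla>F w)\<close>. For an undirected graph the Laplacian operator \<open>\<Lambda>\<close> satisfies \<open>P \<Lambda> = \<Lambda> P = 0\<close>. Hence the
  averages follow a plain stochastic gradient recursion \<open>P w' = P w - \<alpha> P g\<close>, while the disagreement
  \<open>e = w - P w\<close> follows \<open>e' = (I - \<beta> \<Lambda>) e - \<alpha> (g - P g)\<close>. For a connected graph \<open>\<Lambda>\<close> is coercive on the
  kernel of \<open>P\<close>, so that \<open>I - \<beta> \<Lambda>\<close> contracts disagreement as soon as \<open>\<beta>\<close> is small. As every \<open>f i\<close> is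
  Lipschitz, \<open>\<nabla>F\<close> is bounded, and the directions have uniformly bounded second moments.

  Disagreement: Young's inequality gives, for \<open>u = E \<parallel>e\<parallel>\<^sup>2\<close> and large times, a recursion
  \<open>u' + c \<beta> u \<le> u + C \<alpha>\<^sup>2 / \<beta>\<close>. The exponents make \<open>\<alpha>\<^sup>2 / \<beta>\<close> summable. Therefore \<open>u\<close> converges and \<open>\<beta> u\<close> is
  summable, and since \<open>\<beta>\<close> is not summable, \<open>u\<close> tends to \<open>0\<close>
  (lemmas \<open>disagreement_recursion\<close> and \<open>disagreement_null\<close>).

  Gradient at the average: the descent inequality along \<open>P w\<close>, with \<open>\<parallel>P (\<nabla>F (P w)) - P (\<nabla>F w)\<parallel> \<le> L \<parallel>e\<parallel>\<close>,
  shows that \<open>\<alpha> a\<close> is summable for \<open>a = E \<parallel>P (\<nabla>F (P w))\<parallel>\<^sup>2\<close> (lemma \<open>summable_mean_grad_sq\<close>). In one step \<open>P w\<close>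
  moves only by \<open>O(\<alpha>)\<close> in mean, so \<open>a\<close> grows by at most \<open>O(\<alpha>)\<close>. Then \<open>a\<^sup>2\<close> has summable increases, hence
  converges, and its limit is \<open>0\<close> because \<open>\<alpha>\<close> is not summable
  (lemma \<open>slowly_varying_weighted_summable_null\<close>). The claim follows from
  \<open>E \<parallel>P (\<nabla>F w)\<parallel>\<^sup>2 \<le> 2 a + 2 L\<^sup>2 u\<close>.

  The initial iterate is an arbitrary random vector, so the expectations above may be infinite. The
  argument is therefore carried out on each event \<open>\<parallel>w 0\<parallel> \<le> R\<close>, which belongs to all the histories. On
  the complementary event the integrand is bounded, and the probability of that event vanishes as \<open>R\<close>
  grows (lemma \<open>expectation_null_by_localisation\<close>).
\<close>

section \<open>Sequences with summable increases\<close>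

text \<open>Subtracting the partial sums of the allowed increases leaves a decreasing sequence that is bounded below.\<close>

lemma nearly_decreasing_convergent:
  fixes x c :: "nat \<Rightarrow> real"
  assumes nonneg: "\<And>k. 0 \<le> x k" and step: "\<And>k. x (Suc k) \<le> x k + c k" and c: "summable c"
  shows "convergent x"
proof -
  define z where "z k = x k - (\<Sum>j<k. c j)" for k
  have conv: "convergent (\<lambda>n. \<Sum>j<n. c j)"
    using c by (simp add: summable_iff_convergent)
  then obtain K where K: "\<And>n. norm (\<Sum>j<n. c j) \<le> K"
    using convergent_imp_Bseq BseqE by metis
  have "decseq z"
    unfolding z_def using step by (intro decseq_SucI) (simp add: algebra_simps)
  moreover have "\<forall>i. - K \<le> z i"
    unfolding z_def using nonneg K by (smt (verit) real_norm_def)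
  ultimately obtain l where "z \<longlonglongrightarrow> l"
    by (rule decseq_convergent)
  then have "convergent z"
    by (auto simp: convergent_def)
  then have "convergent (\<lambda>k. z k + (\<Sum>j<k. c j))"
    by (intro convergent_add conv)
  then show ?thesis
    by (simp add: z_def)
qed

lemma summable_decrements:
  fixes x c d :: "nat \<Rightarrow> real"
  assumes x: "\<And>k. 0 \<le> x k" and d: "\<And>k. 0 \<le> d k"
    and step: "\<And>k. x (Suc k) + d k \<le> x k + c k" and c: "summable c"
  shows "summable d"
proof -
  have tele: "x n + (\<Sum>j<n. d j) \<le> x 0 + (\<Sum>j<n. c j)" for n
  proof (induction n)
    case (Suc n)
    then show ?case using step[of n] by simp
  qed simp
  have "convergent (\<lambda>n. \<Sum>j<n. c j)"
    using c by (simp add: summable_iff_convergent)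
  then obtain K where K: "\<And>n. norm (\<Sum>j<n. c j) \<le> K"
    using convergent_imp_Bseq BseqE by metis
  have "(\<Sum>j<n. d j) \<le> x 0 + K" for n
    using tele[of n] K[of n] x[of n] by simp
  then show ?thesis
    using d by (intro summableI_nonneg_bounded)
qed

lemma convergent_weighted_summable_null:
  fixes x t :: "nat \<Rightarrow> real"
  assumes conv: "convergent x" and x: "\<And>k. 0 \<le> x k" and t: "\<And>k. 0 \<le> t k"
    and sum: "summable (\<lambda>k. t k * x k)" and div: "\<not> summable t"
  shows "x \<longlonglongrightarrow> 0"
proof -
  obtain l where l: "x \<longlonglongrightarrow> l"
    using conv by (auto simp: convergent_def)
  have "0 \<le> l"
    using l x by (intro LIMSEQ_le_const) auto
  moreover have "\<not> 0 < l"
  proof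
    assume "0 < l"
    then have "eventually (\<lambda>k. l / 2 < x k) sequentially"
      using l by (intro order_tendstoD(1)) auto
    then have ev: "eventually (\<lambda>k. norm (t k) \<le> (2 / l) * (t k * x k)) sequentially"
    proof eventually_elim
      case (elim k)
      have "t k * (l / 2) \<le> t k * x k"
        using elim t by (intro mult_left_mono) auto
      then show ?case
        using \<open>0 < l\<close> t[of k] by (simp add: field_simps)
    qed
    have "summable t"
      by (rule summable_comparison_test_ev[OF ev]) (intro summable_mult sum)
    with div show False by contradiction
  qed
  ultimately show ?thesis using l by simp
qed

text \<open>Weighted summability alone only makes \<open>0\<close> a limit point. Squaring the increment bound turns the
  increase of \<open>x\<^sup>2\<close> into a multiple of \<open>t x\<close> plus a multiple of \<open>t\<^sup>2\<close>, both summable, so \<open>x\<^sup>2\<close> converges.\<close>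

lemma slowly_varying_weighted_summable_null:
  fixes x t :: "nat \<Rightarrow> real"
  assumes x: "\<And>k. 0 \<le> x k" and t: "\<And>k. 0 \<le> t k"
    and step: "\<And>k. x (Suc k) \<le> x k + C * t k" and C: "0 \<le> C"
    and sum: "summable (\<lambda>k. t k * x k)" and div: "\<not> summable t"
    and sq: "summable (\<lambda>k. (t k)\<^sup>2)"
  shows "x \<longlonglongrightarrow> 0"
proof -
  have "(x (Suc k))\<^sup>2 \<le> (x k)\<^sup>2 + (2 * C * (t k * x k) + C\<^sup>2 * (t k)\<^sup>2)" for k
  proof -
    have "(x (Suc k))\<^sup>2 \<le> (x k + C * t k)\<^sup>2"
      using step x by (intro power_mono) auto
    then show ?thesis by (simp add: power2_eq_square algebra_simps)
  qed
  moreover have "summable (\<lambda>k. 2 * C * (t k * x k) + C\<^sup>2 * (t k)\<^sup>2)"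
    by (intro summable_add summable_mult sum sq)
  ultimately have "convergent (\<lambda>k. (x k)\<^sup>2)"
    by (intro nearly_decreasing_convergent) auto
  then obtain l where "(\<lambda>k. (x k)\<^sup>2) \<longlonglongrightarrow> l"
    by (auto simp: convergent_def)
  then have "(\<lambda>k. sqrt ((x k)\<^sup>2)) \<longlonglongrightarrow> sqrt l"
    by (intro tendsto_real_sqrt)
  then have "convergent x"
    using x by (auto simp: convergent_def)
  then show ?thesis
    using x t sum div by (rule convergent_weighted_summable_null)
qed

section \<open>Gradients in inner product spaces\<close>

lemma norm_diff_sq_young:
  fixes u v :: "'a::real_inner"
  assumes "0 < s"
  shows "(norm (u - v))\<^sup>2 \<le> (1 + s) * (norm u)\<^sup>2 + (1 + 1 / s) * (norm v)\<^sup>2"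
proof -
  have "0 \<le> (norm (sqrt s *\<^sub>R u + (1 / sqrt s) *\<^sub>R v))\<^sup>2"
    by simp
  also have "\<dots> = s * (norm u)\<^sup>2 + 2 * (u \<bullet> v) + (1 / s) * (norm v)\<^sup>2"
    using assms
    by (simp add: power2_norm_eq_inner inner_add_left inner_add_right inner_commute field_simps)
  finally show ?thesis
    by (simp add: power2_norm_eq_inner inner_diff_left inner_diff_right inner_commute algebra_simps)
qed

lemma norm_add_sq_le:
  fixes u v :: "'a::real_inner"
  shows "(norm (u + v))\<^sup>2 \<le> 2 * (norm u)\<^sup>2 + 2 * (norm v)\<^sup>2"
  using norm_diff_sq_young[of 1 u "- v"] by simp

lemma real_le_one_plus_sq: "(t :: real) \<le> 1 + t\<^sup>2"
proof -
  have "0 \<le> (t - 1)\<^sup>2 + t\<^sup>2 + 1" by simp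
  then show ?thesis by (simp add: power2_eq_square algebra_simps)
qed

lemma norm_orthogonal_projection_le:
  fixes P :: "'a::real_inner \<Rightarrow> 'a"
  assumes sym: "\<And>u v. P u \<bullet> v = u \<bullet> P v" and idem: "\<And>u. P (P u) = P u"
  shows "norm (P u) \<le> norm u"
proof (cases "P u = 0")
  case False
  have "(norm (P u))\<^sup>2 = u \<bullet> P u"
    by (simp add: power2_norm_eq_inner sym idem)
  also have "\<dots> \<le> norm u * norm (P u)"
    by (rule norm_cauchy_schwarz)
  finally show ?thesis
    using False by (simp add: power2_eq_square)
qed simp

lemma GDERIV_line:
  assumes "GDERIV F (x + t *\<^sub>R v) :> D"
  shows "((\<lambda>t. F (x + t *\<^sub>R v)) has_real_derivative v \<bullet> D) (at t)"
proof -
  have 1: "((\<lambda>t. x + t *\<^sub>R v) has_derivative (\<lambda>h. h *\<^sub>R v)) (at t)"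
    by (auto intro!: derivative_eq_intros)
  have 2: "(F has_derivative (\<lambda>h. h \<bullet> D)) (at (x + t *\<^sub>R v))"
    using assms by (simp add: gderiv_def)
  have "(\<lambda>h. (h *\<^sub>R v) \<bullet> D) = (*) (v \<bullet> D)"
    by (rule ext) (simp only: inner_scaleR_left mult.commute)
  with has_derivative_compose[OF 1 2] show ?thesis
    by (simp only: has_field_derivative_def)
qed

lemma descent_inequality:
  fixes F :: "'a::real_inner \<Rightarrow> real"
  assumes grad: "\<And>x. GDERIV F x :> D x"
    and lip: "\<And>x y. norm (D x - D y) \<le> L * norm (x - y)"
  shows "F y \<le> F x + (y - x) \<bullet> D x + L * (norm (y - x))\<^sup>2"
proof -
  have der: "((\<lambda>t. F (x + t *\<^sub>R (y - x))) has_real_derivative (y - x) \<bullet> D (x + t *\<^sub>R (y - x))) (at t)" for t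
    by (rule GDERIV_line) (rule grad)
  \<comment> \<open>The mean value theorem along the segment; using the Lipschitz bound at the intermediate point
    gives the constant \<open>L\<close> in place of the sharp \<open>L / 2\<close>.\<close>
  obtain t where t: "0 < t" "t < 1" and eq: "F y - F x = (y - x) \<bullet> D (x + t *\<^sub>R (y - x))"
    using MVT2[of 0 1 "\<lambda>t. F (x + t *\<^sub>R (y - x))" "\<lambda>t. (y - x) \<bullet> D (x + t *\<^sub>R (y - x))"] der
    by auto
  have L: "0 \<le> L * norm (y - x)"
    using lip[of y x] norm_ge_zero[of "D y - D x"] by linarith
  have "(y - x) \<bullet> (D (x + t *\<^sub>R (y - x)) - D x) \<le> norm (y - x) * norm (D (x + t *\<^sub>R (y - x)) - D x)"
    by (rule norm_cauchy_schwarz)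
  also have "\<dots> \<le> norm (y - x) * (L * norm (y - x))"
  proof (rule mult_left_mono)
    have "norm (D (x + t *\<^sub>R (y - x)) - D x) \<le> t * (L * norm (y - x))"
      using lip[of "x + t *\<^sub>R (y - x)" x] t by (simp add: mult.left_commute)
    also have "\<dots> \<le> L * norm (y - x)"
      using t L by (intro mult_left_le_one_le) auto
    finally show "norm (D (x + t *\<^sub>R (y - x)) - D x) \<le> L * norm (y - x)" .
  qed simp
  finally show ?thesis
    using eq by (simp add: inner_diff_right power2_eq_square algebra_simps)
qed

lemma grad_eqI:
  assumes "GDERIV f x :> D"
  shows "grad f x = D"
  unfolding grad_def
proof (rule the_equality)
  fix E assume "GDERIV f x :> E"
  then have "(\<lambda>h. h \<bullet> E) = (\<lambda>h. h \<bullet> D)"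
    using assms unfolding gderiv_def by (rule has_derivative_unique)
  then show "E = D"
    by (metis vector_eq_ldot)
qed (rule assms)

lemma differentiable_imp_GDERIV_grad:
  fixes f :: "'a::euclidean_space \<Rightarrow> real"
  assumes "f differentiable (at x)"
  shows "GDERIV f x :> grad f x"
proof -
  obtain f' where f': "(f has_derivative f') (at x)"
    using assms by (auto simp: differentiable_def)
  then have "linear f'"
    by (rule has_derivative_linear)
  \<comment> \<open>The adjoint of a functional, applied to \<open>1\<close>, is its Riesz representative.\<close>
  then have "f' = (\<lambda>h. h \<bullet> adjoint f' 1)"
    using adjoint_works[of f' _ 1] by simp
  with f' have "GDERIV f x :> adjoint f' 1"
    by (simp only: gderiv_def)
  then show ?thesis using grad_eqI by metis
qed

text \<open>The difference quotient in the direction of the gradient itself tends to its squared norm.\<close>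

lemma norm_gradient_le_Lipschitz:
  assumes grad: "GDERIV f x :> D" and lip: "\<And>x y. \<bar>f x - f y\<bar> \<le> K * norm (x - y)"
    and K: "0 \<le> K"
  shows "norm D \<le> K"
proof (cases "D = 0")
  case True
  then show ?thesis using K by simp
next
  case False
  have "((\<lambda>t. f (x + t *\<^sub>R D)) has_real_derivative D \<bullet> D) (at 0)"
    by (rule GDERIV_line) (simp add: grad)
  then have "((\<lambda>t. (f (x + t *\<^sub>R D) - f x) / t) \<longlongrightarrow> D \<bullet> D) (at 0)"
    by (simp add: DERIV_def)
  moreover have "eventually (\<lambda>t. (f (x + t *\<^sub>R D) - f x) / t \<le> K * norm D) (at 0)"
  proof -
    have "(f (x + t *\<^sub>R D) - f x) / t \<le> K * norm D" if "t \<noteq> 0" for t :: real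
    proof -
      have "(f (x + t *\<^sub>R D) - f x) / t \<le> \<bar>f (x + t *\<^sub>R D) - f x\<bar> / \<bar>t\<bar>"
        by (metis abs_divide abs_ge_self)
      also have "\<dots> \<le> K * norm D"
        using lip[of "x + t *\<^sub>R D" x] that by (simp add: field_simps)
      finally show ?thesis .
    qed
    then show ?thesis by (auto simp: eventually_at_filter)
  qed
  ultimately have "D \<bullet> D \<le> K * norm D"
    by (rule tendsto_upperbound) simp
  then show ?thesis
    using False by (simp add: power2_norm_eq_inner[symmetric] power2_eq_square)
qed

section \<open>Stochastic gradient descent with a consensus term\<close>

text \<open>The iteration in coordinate-free form: \<open>P\<close> is the orthogonal projection onto the consensus subspace,
  \<open>\<Lambda>\<close> the Laplacian operator and \<open>D\<close> the gradient of \<open>F\<close>. The measure is finite rather than a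
  probability measure, so that it can be the restriction of one to an event. Conditional unbiasedness of the
  directions enters as orthogonality of \<open>g k - D (x k)\<close> to the bounded functions of \<open>x k\<close>.\<close>

locale consensus_sgd = finite_measure M for M :: "'w measure" +
  fixes F :: "'v::euclidean_space \<Rightarrow> real" and D P \<Lambda> :: "'v \<Rightarrow> 'v"
    and x g :: "nat \<Rightarrow> 'w \<Rightarrow> 'v" and \<alpha> \<beta> :: "nat \<Rightarrow> real"
    and F\<^sub>0 B L S C \<kappa> :: real
  assumes gradient: "\<And>u. GDERIV F u :> D u"
    and D_bounded: "\<And>u. norm (D u) \<le> B"
    and D_lipschitz: "\<And>u v. norm (D u - D v) \<le> L * norm (u - v)"
    and F_bounded_below: "\<And>u. F\<^sub>0 \<le> F u"
    and P_linear: "linear P"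
    and P_idem: "\<And>u. P (P u) = P u"
    and P_sym: "\<And>u v. P u \<bullet> v = u \<bullet> P v"
    and \<Lambda>_linear: "linear \<Lambda>"
    and P_\<Lambda>: "\<And>u. P (\<Lambda> u) = 0"
    and \<Lambda>_P: "\<And>u. \<Lambda> (P u) = 0"
    and \<kappa>_pos: "0 < \<kappa>"
    and coercive: "\<And>u. P u = 0 \<Longrightarrow> \<kappa> * (norm u)\<^sup>2 \<le> u \<bullet> \<Lambda> u"
    and x_measurable [measurable]: "\<And>k. x k \<in> borel_measurable M"
    and g_measurable [measurable]: "\<And>k. g k \<in> borel_measurable M"
    and recursion: "\<And>k \<omega>. \<omega> \<in> space M \<Longrightarrow>
          x (Suc k) \<omega> = x k \<omega> - \<beta> k *\<^sub>R \<Lambda> (x k \<omega>) - \<alpha> k *\<^sub>R g k \<omega>"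
    and x0_square_integrable: "integrable M (\<lambda>\<omega>. (norm (x 0 \<omega>))\<^sup>2)"
    and g_square_integrable: "\<And>k. integrable M (\<lambda>\<omega>. (norm (g k \<omega>))\<^sup>2)"
    and g_second_moment: "\<And>k. (\<integral>\<omega>. (norm (g k \<omega>))\<^sup>2 \<partial>M) \<le> S"
    and unbiased: "\<And>k \<phi>. \<phi> \<in> borel_measurable borel \<Longrightarrow> bounded (range \<phi>) \<Longrightarrow>
          (\<integral>\<omega>. \<phi> (x k \<omega>) \<bullet> g k \<omega> \<partial>M) = (\<integral>\<omega>. \<phi> (x k \<omega>) \<bullet> D (x k \<omega>) \<partial>M)"
    and \<alpha>_pos: "\<And>k. 0 < \<alpha> k" and \<beta>_pos: "\<And>k. 0 < \<beta> k"
    and \<alpha>_le_\<beta>: "\<And>k. \<alpha> k \<le> C * \<beta> k"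
    and \<beta>_null: "\<beta> \<longlonglongrightarrow> 0"
    and \<alpha>_diverges: "\<not> summable \<alpha>"
    and \<alpha>_sq_summable: "summable (\<lambda>k. (\<alpha> k)\<^sup>2)"
    and \<alpha>_sq_over_\<beta>_summable: "summable (\<lambda>k. (\<alpha> k)\<^sup>2 / \<beta> k)"
begin

lemma L_nonneg: "0 \<le> L"
proof -
  obtain b :: 'v where "b \<in> Basis" using nonempty_Basis by blast
  then have "norm (D b - D 0) \<le> L"
    using D_lipschitz[of b 0] by simp
  then show ?thesis by (rule order_trans[OF norm_ge_zero])
qed

lemma B_nonneg: "0 \<le> B"
  using D_bounded[of 0] norm_ge_zero by (rule order_trans[rotated])

lemma norm_P_le: "norm (P u) \<le> norm u"
  by (rule norm_orthogonal_projection_le[OF P_sym P_idem])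

lemma norm_minus_P_le: "norm (u - P u) \<le> norm u"
proof -
  have "(norm (u - P u))\<^sup>2 = (norm u)\<^sup>2 - (norm (P u))\<^sup>2"
    by (simp add: power2_norm_eq_inner inner_diff_left inner_diff_right P_sym P_idem)
  then have "(norm (u - P u))\<^sup>2 \<le> (norm u)\<^sup>2" by simp
  then show ?thesis by (rule power2_le_imp_le) simp
qed

lemma P_simps: "P (u + v) = P u + P v" "P (u - v) = P u - P v" "P (c *\<^sub>R u) = c *\<^sub>R P u"
  using P_linear by (simp_all add: linear_add linear_diff linear_scale)

lemma \<Lambda>_simps: "\<Lambda> (u - v) = \<Lambda> u - \<Lambda> v" "\<Lambda> (c *\<^sub>R u) = c *\<^sub>R \<Lambda> u"
  using \<Lambda>_linear by (simp_all add: linear_diff linear_scale)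

lemma measurable_operators [measurable]:
  "P \<in> borel_measurable borel" "\<Lambda> \<in> borel_measurable borel"
  "D \<in> borel_measurable borel" "F \<in> borel_measurable borel"
proof -
  show "P \<in> borel_measurable borel" "\<Lambda> \<in> borel_measurable borel"
    using P_linear \<Lambda>_linear
    by (auto intro!: borel_measurable_continuous_onI linear_continuous_on
        simp: linear_conv_bounded_linear)
  have "continuous_on UNIV D"
    using D_lipschitz L_nonneg
    by (intro lipschitz_on_continuous_on[of L]) (auto intro!: lipschitz_onI simp: dist_norm)
  then show "D \<in> borel_measurable borel"
    by (rule borel_measurable_continuous_onI)
  have "continuous_on UNIV F"
    using gradient unfolding gderiv_def
    by (meson continuous_at_imp_continuous_on has_derivative_continuous)
  then show "F \<in> borel_measurable borel"
    by (rule borel_measurable_continuous_onI)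
qed

lemma \<Lambda>_bound_exists:
  obtains K where "0 < K" "\<And>u. norm (\<Lambda> u) \<le> K * norm u"
proof -
  obtain K where "0 < K" "\<And>u. norm (\<Lambda> u) \<le> norm u * K"
    using bounded_linear.pos_bounded \<Lambda>_linear linear_conv_bounded_linear by metis
  then show ?thesis using that by (simp add: mult.commute)
qed

text \<open>Expanding the square, the first-order term gains
  \<open>2 \<kappa> t\<close> by coercivity, and the second-order term costs at most \<open>t\<^sup>2 K\<^sup>2 \<le> \<kappa> t\<close>.\<close>

lemma disagreement_contraction:
  assumes K: "\<And>u. norm (\<Lambda> u) \<le> K * norm u" and t: "0 < t" "t * K\<^sup>2 \<le> \<kappa>"
    and e: "P e = 0"
  shows "(norm (e - t *\<^sub>R \<Lambda> e))\<^sup>2 \<le> (1 - \<kappa> * t) * (norm e)\<^sup>2"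
proof -
  have 1: "(norm (e - t *\<^sub>R \<Lambda> e))\<^sup>2 = (norm e)\<^sup>2 - 2 * t * (e \<bullet> \<Lambda> e) + t\<^sup>2 * (norm (\<Lambda> e))\<^sup>2"
    unfolding power2_norm_eq_inner
    by (simp add: inner_diff_left inner_diff_right inner_commute power2_eq_square algebra_simps)
  have 2: "t * (\<kappa> * (norm e)\<^sup>2) \<le> t * (e \<bullet> \<Lambda> e)"
    using coercive[OF e] t by (intro mult_left_mono) auto
  have "(norm (\<Lambda> e))\<^sup>2 \<le> K\<^sup>2 * (norm e)\<^sup>2"
    using power_mono[OF K, of e 2] by (simp add: power_mult_distrib)
  then have "t * (t * (norm (\<Lambda> e))\<^sup>2) \<le> t * (t * (K\<^sup>2 * (norm e)\<^sup>2))"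
    using t by (intro mult_left_mono) auto
  also have "\<dots> = t * (t * K\<^sup>2 * (norm e)\<^sup>2)" by simp
  also have "\<dots> \<le> t * (\<kappa> * (norm e)\<^sup>2)"
    using t by (intro mult_left_mono mult_right_mono) auto
  finally have 3: "t\<^sup>2 * (norm (\<Lambda> e))\<^sup>2 \<le> t * (\<kappa> * (norm e)\<^sup>2)"
    by (simp add: power2_eq_square)
  show ?thesis unfolding 1 using 2 3 by (simp add: algebra_simps)
qed

text \<open>The direction may be correlated with the disagreement and its mean does not vanish, so the cross
  term is absorbed by Young's inequality. The parameter \<open>\<kappa> b / 2\<close> gives away half of the contraction,
  and its inverse is the source of the factor \<open>a\<^sup>2 / b\<close>.\<close>

lemma disagreement_step:
  assumes K: "\<And>u. norm (\<Lambda> u) \<le> K * norm u"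
    and b: "0 < b" "b \<le> 1" "b * K\<^sup>2 \<le> \<kappa>"
    and y: "y = u - b *\<^sub>R \<Lambda> u - a *\<^sub>R v"
  shows "(norm (y - P y))\<^sup>2 \<le>
    (1 - \<kappa> / 2 * b) * (norm (u - P u))\<^sup>2 + (1 + 2 / \<kappa>) * (a\<^sup>2 / b * (norm v)\<^sup>2)"
proof -
  define e where "e = u - P u"
  define s where "s = \<kappa> * b / 2"
  have s: "0 < s" using \<kappa>_pos b by (simp add: s_def)
  have e: "P e = 0" and \<Lambda>e: "\<Lambda> e = \<Lambda> u"
    by (simp_all add: e_def P_simps P_idem \<Lambda>_simps \<Lambda>_P)
  have eq: "y - P y = (e - b *\<^sub>R \<Lambda> e) - a *\<^sub>R (v - P v)"
    unfolding \<Lambda>e unfolding y e_def by (simp add: P_simps P_\<Lambda> algebra_simps)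
  have "(1 + s) * (norm (e - b *\<^sub>R \<Lambda> e))\<^sup>2 \<le> (1 + s) * ((1 - \<kappa> * b) * (norm e)\<^sup>2)"
    using disagreement_contraction[OF K b(1) b(3) e] s by (intro mult_left_mono) auto
  also have "\<dots> = ((1 + s) * (1 - 2 * s)) * (norm e)\<^sup>2"
    by (simp add: s_def)
  also have "\<dots> \<le> (1 - s) * (norm e)\<^sup>2"
    using s by (intro mult_right_mono) (auto simp: algebra_simps)
  finally have 1: "(1 + s) * (norm (e - b *\<^sub>R \<Lambda> e))\<^sup>2 \<le> (1 - s) * (norm e)\<^sup>2" .
  have "(1 + 1 / s) * (norm (a *\<^sub>R (v - P v)))\<^sup>2 = (1 + 1 / s) * (a\<^sup>2 * (norm (v - P v))\<^sup>2)"
    by (simp add: power_mult_distrib)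
  also have "\<dots> \<le> (1 + 1 / s) * (a\<^sup>2 * (norm v)\<^sup>2)"
    using s norm_minus_P_le[of v] by (intro mult_left_mono power_mono) auto
  also have "\<dots> \<le> ((1 + 2 / \<kappa>) / b) * (a\<^sup>2 * (norm v)\<^sup>2)"
    using b \<kappa>_pos by (intro mult_right_mono) (auto simp: s_def field_simps)
  finally have 2: "(1 + 1 / s) * (norm (a *\<^sub>R (v - P v)))\<^sup>2
      \<le> (1 + 2 / \<kappa>) * (a\<^sup>2 / b * (norm v)\<^sup>2)" by simp
  show ?thesis
    using norm_diff_sq_young[OF s, of "e - b *\<^sub>R \<Lambda> e" "a *\<^sub>R (v - P v)"] 1 2
    unfolding eq by (simp add: s_def e_def)
qed

subsection \<open>Square integrability\<close>

lemma x_square_integrable: "integrable M (\<lambda>\<omega>. (norm (x k \<omega>))\<^sup>2)"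
proof (induction k)
  case 0
  show ?case by (rule x0_square_integrable)
next
  case (Suc k)
  obtain K where K: "0 < K" "\<And>u. norm (\<Lambda> u) \<le> K * norm u"
    using \<Lambda>_bound_exists by blast
  have "integrable M (\<lambda>\<omega>. 2 * ((1 + \<beta> k * K)\<^sup>2 * (norm (x k \<omega>))\<^sup>2)
      + 2 * ((\<alpha> k)\<^sup>2 * (norm (g k \<omega>))\<^sup>2))"
    by (intro Bochner_Integration.integrable_add integrable_mult_right Suc g_square_integrable)
  then show ?case
  proof (rule Bochner_Integration.integrable_bound)
    show "AE \<omega> in M. norm ((norm (x (Suc k) \<omega>))\<^sup>2) \<le> norm
      (2 * ((1 + \<beta> k * K)\<^sup>2 * (norm (x k \<omega>))\<^sup>2) + 2 * ((\<alpha> k)\<^sup>2 * (norm (g k \<omega>))\<^sup>2))"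
    proof (rule AE_I2)
      fix \<omega> assume \<omega>: "\<omega> \<in> space M"
      have "norm (x k \<omega> - \<beta> k *\<^sub>R \<Lambda> (x k \<omega>)) \<le> norm (x k \<omega>) + norm (\<beta> k *\<^sub>R \<Lambda> (x k \<omega>))"
        by (rule norm_triangle_ineq4)
      also have "\<dots> = norm (x k \<omega>) + \<beta> k * norm (\<Lambda> (x k \<omega>))"
        using \<beta>_pos[of k] by simp
      also have "\<dots> \<le> norm (x k \<omega>) + \<beta> k * (K * norm (x k \<omega>))"
        by (intro add_left_mono mult_left_mono[OF K(2) less_imp_le[OF \<beta>_pos]])
      finally have "norm (x k \<omega> - \<beta> k *\<^sub>R \<Lambda> (x k \<omega>)) \<le> (1 + \<beta> k * K) * norm (x k \<omega>)"
        by (simp add: algebra_simps)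
      then have "(norm (x k \<omega> - \<beta> k *\<^sub>R \<Lambda> (x k \<omega>)))\<^sup>2 \<le> (1 + \<beta> k * K)\<^sup>2 * (norm (x k \<omega>))\<^sup>2"
        unfolding power_mult_distrib[symmetric] by (rule power_mono) simp
      then show "norm ((norm (x (Suc k) \<omega>))\<^sup>2) \<le> norm
        (2 * ((1 + \<beta> k * K)\<^sup>2 * (norm (x k \<omega>))\<^sup>2) + 2 * ((\<alpha> k)\<^sup>2 * (norm (g k \<omega>))\<^sup>2))"
        using norm_add_sq_le[of "x k \<omega> - \<beta> k *\<^sub>R \<Lambda> (x k \<omega>)" "- (\<alpha> k *\<^sub>R g k \<omega>)"]
        by (simp add: recursion[OF \<omega>] power_mult_distrib)
    qed
  qed simp
qed

lemma integrable_dominated_by_norms: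
  assumes [measurable]: "f \<in> borel_measurable M"
    and le: "\<And>\<omega>. \<omega> \<in> space M \<Longrightarrow> \<bar>f \<omega>\<bar> \<le> c + d * (norm (x k \<omega>))\<^sup>2 + h * (norm (g k \<omega>))\<^sup>2"
  shows "integrable M (f :: 'w \<Rightarrow> real)"
proof (rule Bochner_Integration.integrable_bound)
  show "integrable M (\<lambda>\<omega>. c + d * (norm (x k \<omega>))\<^sup>2 + h * (norm (g k \<omega>))\<^sup>2)"
    by (intro Bochner_Integration.integrable_add integrable_mult_right x_square_integrable
        g_square_integrable integrable_const)
  show "AE \<omega> in M. norm (f \<omega>) \<le> norm (c + d * (norm (x k \<omega>))\<^sup>2 + h * (norm (g k \<omega>))\<^sup>2)"
    using le by (intro AE_I2) fastforce
qed simp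

lemma integrable_disagreement: "integrable M (\<lambda>\<omega>. (norm (x k \<omega> - P (x k \<omega>)))\<^sup>2)"
  by (rule integrable_dominated_by_norms[where c = 0 and d = 1 and h = 0 and k = k])
    (auto intro!: power_mono norm_minus_P_le)

text \<open>A bounded gradient makes \<open>F\<close> grow at most linearly; the descent inequality between \<open>0\<close> and \<open>P x\<close>,
  used in both directions, already gives the quadratic growth that suffices here.\<close>

lemma integrable_objective: "integrable M (\<lambda>\<omega>. F (P (x k \<omega>)))"
proof (rule integrable_dominated_by_norms[where c = "\<bar>F 0\<bar> + B" and d = "B + L" and h = 0 and k = k])
  fix \<omega>
  let ?p = "P (x k \<omega>)"
  have "F ?p \<le> F 0 + ?p \<bullet> D 0 + L * (norm ?p)\<^sup>2"
    using descent_inequality[OF gradient D_lipschitz, of ?p 0] by simp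
  moreover have "F 0 \<le> F ?p + (- ?p) \<bullet> D ?p + L * (norm ?p)\<^sup>2"
    using descent_inequality[OF gradient D_lipschitz, of 0 ?p] by simp
  moreover have "\<bar>?p \<bullet> D u\<bar> \<le> B + B * (norm (x k \<omega>))\<^sup>2" for u
  proof -
    have "\<bar>?p \<bullet> D u\<bar> \<le> norm ?p * norm (D u)" by (rule Cauchy_Schwarz_ineq2)
    also have "\<dots> \<le> (1 + (norm (x k \<omega>))\<^sup>2) * B"
      using D_bounded[of u] real_le_one_plus_sq[of "norm (x k \<omega>)"] norm_P_le[of "x k \<omega>"]
      by (intro mult_mono) auto
    finally show ?thesis by (simp add: algebra_simps)
  qed
  note this[of 0] this[of ?p]
  moreover have "L * (norm ?p)\<^sup>2 \<le> L * (norm (x k \<omega>))\<^sup>2"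
    using norm_P_le L_nonneg by (intro mult_left_mono power_mono) auto
  ultimately show "\<bar>F ?p\<bar> \<le> \<bar>F 0\<bar> + B + (B + L) * (norm (x k \<omega>))\<^sup>2 + 0 * (norm (g k \<omega>))\<^sup>2"
    unfolding inner_minus_left distrib_right by linarith
qed simp

lemma integrable_averaged_gradients:
  "integrable M (\<lambda>\<omega>. (norm (P (D (P (x k \<omega>)))))\<^sup>2)"
  "integrable M (\<lambda>\<omega>. (norm (P (D (x k \<omega>))))\<^sup>2)"
proof -
  have "norm (P (D u)) \<le> B" for u
    using norm_P_le D_bounded by (rule order_trans)
  then have "(norm (P (D u)))\<^sup>2 \<le> B\<^sup>2" for u
    by (intro power_mono) auto
  then show "integrable M (\<lambda>\<omega>. (norm (P (D (P (x k \<omega>)))))\<^sup>2)"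
    "integrable M (\<lambda>\<omega>. (norm (P (D (x k \<omega>))))\<^sup>2)"
    by (intro integrable_dominated_by_norms[where c = "B\<^sup>2" and d = 0 and h = 0 and k = k]; simp)+
qed

subsection \<open>The disagreement vanishes\<close>

definition disagreement :: "nat \<Rightarrow> real" where
  "disagreement k = (\<integral>\<omega>. (norm (x k \<omega> - P (x k \<omega>)))\<^sup>2 \<partial>M)"

text \<open>The gradient is taken at the averaged iterate: there a step changes it by \<open>O(\<alpha>)\<close>, whereas the
  iterate itself also moves by the consensus term \<open>\<beta> \<Lambda> x\<close>.\<close>

definition mean_grad_sq :: "nat \<Rightarrow> real" where
  "mean_grad_sq k = (\<integral>\<omega>. (norm (P (D (P (x k \<omega>)))))\<^sup>2 \<partial>M)"

lemma disagreement_nonneg: "0 \<le> disagreement k"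
  by (simp add: disagreement_def)

lemma mean_grad_sq_nonneg: "0 \<le> mean_grad_sq k"
  by (simp add: mean_grad_sq_def)

lemma \<beta>_diverges: "\<not> summable \<beta>"
proof
  assume "summable \<beta>"
  then have "summable (\<lambda>k. C * \<beta> k)" by (rule summable_mult)
  then have "summable \<alpha>"
    by (rule summable_comparison_test'[where N = 0]) (use \<alpha>_le_\<beta> \<alpha>_pos in \<open>auto simp: less_imp_le\<close>)
  with \<alpha>_diverges show False ..
qed

text \<open>Valid only from the time on at which \<open>\<beta>\<close> is small enough for the contraction.\<close>

lemma disagreement_recursion:
  obtains k\<^sub>0 where "\<And>k. k\<^sub>0 \<le> k \<Longrightarrow> disagreement (Suc k) + \<kappa> / 2 * (\<beta> k * disagreement k)
    \<le> disagreement k + (1 + 2 / \<kappa>) * (S * ((\<alpha> k)\<^sup>2 / \<beta> k))"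
proof -
  obtain K where K: "0 < K" "\<And>u. norm (\<Lambda> u) \<le> K * norm u"
    using \<Lambda>_bound_exists by blast
  define \<epsilon> where "\<epsilon> = min 1 (\<kappa> / K\<^sup>2)"
  have "0 < \<epsilon>" using \<kappa>_pos K by (simp add: \<epsilon>_def)
  with \<beta>_null have "eventually (\<lambda>k. \<beta> k < \<epsilon>) sequentially"
    by (rule order_tendstoD)
  then obtain k\<^sub>0 where k0: "\<And>k. k\<^sub>0 \<le> k \<Longrightarrow> \<beta> k < \<epsilon>"
    by (auto simp: eventually_sequentially)
  show ?thesis
  proof (rule that)
    fix k assume "k\<^sub>0 \<le> k"
    then have b: "\<beta> k \<le> 1" "\<beta> k * K\<^sup>2 \<le> \<kappa>"
      using k0[of k] K by (auto simp: \<epsilon>_def field_simps)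
    have "disagreement (Suc k) \<le>
        (\<integral>\<omega>. (1 - \<kappa> / 2 * \<beta> k) * (norm (x k \<omega> - P (x k \<omega>)))\<^sup>2
          + (1 + 2 / \<kappa>) * ((\<alpha> k)\<^sup>2 / \<beta> k * (norm (g k \<omega>))\<^sup>2) \<partial>M)"
      unfolding disagreement_def
    proof (rule integral_mono)
      show "integrable M (\<lambda>\<omega>. (1 - \<kappa> / 2 * \<beta> k) * (norm (x k \<omega> - P (x k \<omega>)))\<^sup>2
          + (1 + 2 / \<kappa>) * ((\<alpha> k)\<^sup>2 / \<beta> k * (norm (g k \<omega>))\<^sup>2))"
        by (intro Bochner_Integration.integrable_add integrable_mult_right
            integrable_disagreement g_square_integrable)
    next
      fix \<omega> assume "\<omega> \<in> space M"
      then show "(norm (x (Suc k) \<omega> - P (x (Suc k) \<omega>)))\<^sup>2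
        \<le> (1 - \<kappa> / 2 * \<beta> k) * (norm (x k \<omega> - P (x k \<omega>)))\<^sup>2
          + (1 + 2 / \<kappa>) * ((\<alpha> k)\<^sup>2 / \<beta> k * (norm (g k \<omega>))\<^sup>2)"
        by (intro disagreement_step[OF K(2) \<beta>_pos b] recursion)
    qed (rule integrable_disagreement)
    also have "\<dots> = (1 - \<kappa> / 2 * \<beta> k) * disagreement k
        + (1 + 2 / \<kappa>) * ((\<alpha> k)\<^sup>2 / \<beta> k * (\<integral>\<omega>. (norm (g k \<omega>))\<^sup>2 \<partial>M))"
      unfolding disagreement_def
      by (subst Bochner_Integration.integral_add)
        (auto intro!: integrable_mult_right integrable_disagreement g_square_integrable)
    also have "\<dots> \<le> (1 - \<kappa> / 2 * \<beta> k) * disagreement k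
        + (1 + 2 / \<kappa>) * ((\<alpha> k)\<^sup>2 / \<beta> k * S)"
      using \<kappa>_pos \<beta>_pos[of k] g_second_moment[of k] by (intro add_left_mono mult_left_mono) auto
    finally show "disagreement (Suc k) + \<kappa> / 2 * (\<beta> k * disagreement k)
      \<le> disagreement k + (1 + 2 / \<kappa>) * (S * ((\<alpha> k)\<^sup>2 / \<beta> k))"
      by (simp add: algebra_simps)
  qed
qed

text \<open>The recursion has summable perturbations \<open>\<alpha>\<^sup>2 / \<beta>\<close>. It therefore yields at once convergence of the
  disagreement and summability of the decrements \<open>\<beta> u\<close>; as \<open>\<beta>\<close> diverges, only the limit \<open>0\<close> is possible.\<close>

lemma
  shows summable_\<beta>_disagreement: "summable (\<lambda>k. \<beta> k * disagreement k)"
    and disagreement_null: "disagreement \<longlonglongrightarrow> 0"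
proof -
  obtain k\<^sub>0 where rec: "\<And>k. k\<^sub>0 \<le> k \<Longrightarrow> disagreement (Suc k) + \<kappa> / 2 * (\<beta> k * disagreement k)
    \<le> disagreement k + (1 + 2 / \<kappa>) * (S * ((\<alpha> k)\<^sup>2 / \<beta> k))"
    using disagreement_recursion by blast
  define c where "c k = (1 + 2 / \<kappa>) * (S * ((\<alpha> k)\<^sup>2 / \<beta> k))" for k
  have "summable c"
    unfolding c_def by (intro summable_mult \<alpha>_sq_over_\<beta>_summable)
  then have c: "summable (\<lambda>k. c (k + k\<^sub>0))"
    by (rule summable_ignore_initial_segment)
  have dec: "0 \<le> \<kappa> / 2 * (\<beta> k * disagreement k)" for k
    using \<kappa>_pos \<beta>_pos[of k] disagreement_nonneg by simp
  have step: "disagreement (Suc k + k\<^sub>0) + \<kappa> / 2 * (\<beta> (k + k\<^sub>0) * disagreement (k + k\<^sub>0))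
      \<le> disagreement (k + k\<^sub>0) + c (k + k\<^sub>0)" for k
    using rec[of "k + k\<^sub>0"] by (simp add: c_def)
  have "summable (\<lambda>k. \<kappa> / 2 * (\<beta> (k + k\<^sub>0) * disagreement (k + k\<^sub>0)))"
    by (rule summable_decrements[OF disagreement_nonneg dec step c])
  then have "summable (\<lambda>k. \<beta> (k + k\<^sub>0) * disagreement (k + k\<^sub>0))"
    using \<kappa>_pos summable_cmult_iff[of "\<kappa> / 2" "\<lambda>k. \<beta> (k + k\<^sub>0) * disagreement (k + k\<^sub>0)"] by simp
  then show sum: "summable (\<lambda>k. \<beta> k * disagreement k)"
    by (subst (asm) summable_iff_shift)
  have "convergent (\<lambda>k. disagreement (k + k\<^sub>0))"
    by (rule nearly_decreasing_convergent[OF disagreement_nonneg _ c])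
      (use step dec in \<open>smt (verit)\<close>)
  then have "convergent disagreement"
    by (simp add: convergent_ignore_initial_segment)
  then show "disagreement \<longlonglongrightarrow> 0"
    using disagreement_nonneg less_imp_le[OF \<beta>_pos] sum \<beta>_diverges
    by (rule convergent_weighted_summable_null)
qed

lemma summable_\<alpha>_disagreement: "summable (\<lambda>k. \<alpha> k * disagreement k)"
proof (rule summable_comparison_test'[where N = 0])
  show "summable (\<lambda>k. C * (\<beta> k * disagreement k))"
    by (intro summable_mult summable_\<beta>_disagreement)
  show "norm (\<alpha> k * disagreement k) \<le> C * (\<beta> k * disagreement k)" for k
    using mult_right_mono[OF \<alpha>_le_\<beta> disagreement_nonneg, of k k] \<alpha>_pos[of k] disagreement_nonneg[of k]
    by (simp add: mult.assoc)
qed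

subsection \<open>The gradient at the average vanishes\<close>

lemma P_recursion:
  assumes "\<omega> \<in> space M"
  shows "P (x (Suc k) \<omega>) - P (x k \<omega>) = - \<alpha> k *\<^sub>R P (g k \<omega>)"
  using recursion[OF assms] by (simp add: P_simps P_\<Lambda>)

lemma integrable_inner_g: "integrable M (\<lambda>\<omega>. P (D (P (x k \<omega>))) \<bullet> g k \<omega>)"
proof (rule integrable_dominated_by_norms[where c = B and d = 0 and h = B and k = k])
  fix \<omega>
  have "\<bar>P (D (P (x k \<omega>))) \<bullet> g k \<omega>\<bar> \<le> norm (P (D (P (x k \<omega>)))) * norm (g k \<omega>)"
    by (rule Cauchy_Schwarz_ineq2)
  also have "\<dots> \<le> B * (1 + (norm (g k \<omega>))\<^sup>2)"
    using real_le_one_plus_sq B_nonneg order_trans[OF norm_P_le D_bounded]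
    by (intro mult_mono) auto
  finally show "\<bar>P (D (P (x k \<omega>))) \<bullet> g k \<omega>\<bar>
      \<le> B + 0 * (norm (x k \<omega>))\<^sup>2 + B * (norm (g k \<omega>))\<^sup>2"
    by (simp add: algebra_simps)
qed simp

lemma integrable_inner_D: "integrable M (\<lambda>\<omega>. P (D (P (x k \<omega>))) \<bullet> D (x k \<omega>))"
proof (rule integrable_dominated_by_norms[where c = "B * B" and d = 0 and h = 0 and k = k])
  fix \<omega>
  have "\<bar>P (D (P (x k \<omega>))) \<bullet> D (x k \<omega>)\<bar> \<le> norm (P (D (P (x k \<omega>)))) * norm (D (x k \<omega>))"
    by (rule Cauchy_Schwarz_ineq2)
  also have "\<dots> \<le> B * B"
    using D_bounded B_nonneg order_trans[OF norm_P_le D_bounded]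
    by (intro mult_mono) auto
  finally show "\<bar>P (D (P (x k \<omega>))) \<bullet> D (x k \<omega>)\<bar>
      \<le> B * B + 0 * (norm (x k \<omega>))\<^sup>2 + 0 * (norm (g k \<omega>))\<^sup>2"
    by simp
qed simp

text \<open>By unbiasedness the direction may be replaced by the gradient at the iterate. The polarisation
  identity compares it with the gradient at the average, at the price of the squared distance of the
  two projected gradients, which the Lipschitz condition bounds by the disagreement.\<close>

lemma expected_direction:
  "mean_grad_sq k / 2 - L\<^sup>2 / 2 * disagreement k \<le> (\<integral>\<omega>. P (D (P (x k \<omega>))) \<bullet> g k \<omega> \<partial>M)"
proof -
  have "mean_grad_sq k / 2 - L\<^sup>2 / 2 * disagreement k
      = (\<integral>\<omega>. (norm (P (D (P (x k \<omega>)))))\<^sup>2 / 2 - L\<^sup>2 / 2 * (norm (x k \<omega> - P (x k \<omega>)))\<^sup>2 \<partial>M)"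
    unfolding mean_grad_sq_def disagreement_def
    by (subst Bochner_Integration.integral_diff)
      (auto intro!: integrable_averaged_gradients integrable_mult_right integrable_disagreement)
  also have "\<dots> \<le> (\<integral>\<omega>. P (D (P (x k \<omega>))) \<bullet> D (x k \<omega>) \<partial>M)"
  proof (rule integral_mono)
    fix \<omega>
    define p where "p = D (P (x k \<omega>))"
    define q where "q = D (x k \<omega>)"
    have "norm (P p - P q) \<le> norm (q - p)"
      using norm_P_le[of "p - q"] by (simp add: P_simps norm_minus_commute)
    also have "\<dots> \<le> L * norm (x k \<omega> - P (x k \<omega>))"
      unfolding p_def q_def by (rule D_lipschitz)
    finally have "(norm (P p - P q))\<^sup>2 \<le> L\<^sup>2 * (norm (x k \<omega> - P (x k \<omega>)))\<^sup>2"
      unfolding power_mult_distrib[symmetric] by (rule power_mono) simp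
    moreover have "(norm (P p - P q))\<^sup>2 = (norm (P p))\<^sup>2 + (norm (P q))\<^sup>2 - 2 * (P p \<bullet> P q)"
      unfolding power2_norm_eq_inner
      by (simp add: inner_diff_left inner_diff_right inner_commute)
    moreover have "P p \<bullet> P q = P p \<bullet> q"
      by (simp add: P_sym P_idem)
    moreover have "0 \<le> (norm (P q))\<^sup>2" by simp
    ultimately have "(norm (P p))\<^sup>2 / 2 - L\<^sup>2 / 2 * (norm (x k \<omega> - P (x k \<omega>)))\<^sup>2 \<le> P p \<bullet> q"
      by linarith
    then show "(norm (P (D (P (x k \<omega>)))))\<^sup>2 / 2 - L\<^sup>2 / 2 * (norm (x k \<omega> - P (x k \<omega>)))\<^sup>2
        \<le> P (D (P (x k \<omega>))) \<bullet> D (x k \<omega>)"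
      by (simp add: p_def q_def)
  qed (auto intro!: integrable_averaged_gradients integrable_mult_right integrable_disagreement
        integrable_inner_D)
  also have "\<dots> = (\<integral>\<omega>. P (D (P (x k \<omega>))) \<bullet> g k \<omega> \<partial>M)"
  proof (rule unbiased[symmetric])
    show "bounded (range (\<lambda>u. P (D (P u))))"
      by (rule boundedI[of _ B]) (auto intro: order_trans[OF norm_P_le D_bounded])
  qed simp
  finally show ?thesis .
qed

definition excess :: "nat \<Rightarrow> real" where
  "excess k = (\<integral>\<omega>. F (P (x k \<omega>)) - F\<^sub>0 \<partial>M)"

lemma excess_nonneg: "0 \<le> excess k"
  unfolding excess_def using F_bounded_below by (intro Bochner_Integration.integral_nonneg) auto

text \<open>The descent inequality between consecutive averages; the consensus term is invisible to \<open>P\<close>.\<close>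

lemma excess_step:
  "excess (Suc k) + \<alpha> k * mean_grad_sq k / 2
    \<le> excess k + (L\<^sup>2 / 2 * (\<alpha> k * disagreement k) + L * S * (\<alpha> k)\<^sup>2)"
proof -
  have int: "integrable M (\<lambda>\<omega>. F (P (x k \<omega>)) - F\<^sub>0)" for k
    by (intro Bochner_Integration.integrable_diff integrable_objective integrable_const)
  have "excess (Suc k) \<le> (\<integral>\<omega>. (F (P (x k \<omega>)) - F\<^sub>0) - \<alpha> k * (P (D (P (x k \<omega>))) \<bullet> g k \<omega>)
      + L * (\<alpha> k)\<^sup>2 * (norm (g k \<omega>))\<^sup>2 \<partial>M)"
    unfolding excess_def
  proof (rule integral_mono)
    fix \<omega> assume \<omega>: "\<omega> \<in> space M"
    let ?p = "P (x k \<omega>)" and ?q = "P (x (Suc k) \<omega>)"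
    have "F ?q \<le> F ?p + (?q - ?p) \<bullet> D ?p + L * (norm (?q - ?p))\<^sup>2"
      by (rule descent_inequality[OF gradient D_lipschitz])
    moreover have "(?q - ?p) \<bullet> D ?p = - \<alpha> k * (P (D ?p) \<bullet> g k \<omega>)"
      unfolding P_recursion[OF \<omega>] by (simp add: P_sym inner_commute)
    moreover have "L * (norm (?q - ?p))\<^sup>2 \<le> L * ((\<alpha> k)\<^sup>2 * (norm (g k \<omega>))\<^sup>2)"
      unfolding P_recursion[OF \<omega>] using L_nonneg norm_P_le
      by (intro mult_left_mono) (auto simp: power_mult_distrib intro!: mult_left_mono power_mono)
    ultimately show "F ?q - F\<^sub>0 \<le> (F ?p - F\<^sub>0) - \<alpha> k * (P (D ?p) \<bullet> g k \<omega>)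
      + L * (\<alpha> k)\<^sup>2 * (norm (g k \<omega>))\<^sup>2" by simp
  qed (intro int Bochner_Integration.integrable_add Bochner_Integration.integrable_diff
        integrable_mult_right integrable_inner_g g_square_integrable)+
  also have "\<dots> = excess k - \<alpha> k * (\<integral>\<omega>. P (D (P (x k \<omega>))) \<bullet> g k \<omega> \<partial>M)
      + L * (\<alpha> k)\<^sup>2 * (\<integral>\<omega>. (norm (g k \<omega>))\<^sup>2 \<partial>M)"
    unfolding excess_def
    by (simp only: Bochner_Integration.integral_add Bochner_Integration.integral_diff
        Bochner_Integration.integrable_diff integrable_mult_right integral_mult_right_zero
        int integrable_inner_g g_square_integrable)
  also have "\<dots> \<le> excess k - \<alpha> k * (mean_grad_sq k / 2 - L\<^sup>2 / 2 * disagreement k)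
      + L * (\<alpha> k)\<^sup>2 * S"
    using \<alpha>_pos[of k] L_nonneg expected_direction[of k] g_second_moment[of k]
    by (intro add_mono diff_left_mono mult_left_mono) auto
  finally show ?thesis by (simp add: algebra_simps)
qed

lemma summable_mean_grad_sq: "summable (\<lambda>k. \<alpha> k * mean_grad_sq k)"
proof -
  have "summable (\<lambda>k. \<alpha> k * mean_grad_sq k / 2)"
  proof (rule summable_decrements[where x = excess])
    show "summable (\<lambda>k. L\<^sup>2 / 2 * (\<alpha> k * disagreement k) + L * S * (\<alpha> k)\<^sup>2)"
      by (rule summable_add[OF summable_mult[OF summable_\<alpha>_disagreement]
            summable_mult[OF \<alpha>_sq_summable]])
    show "0 \<le> \<alpha> k * mean_grad_sq k / 2" for k
      using \<alpha>_pos[of k] mean_grad_sq_nonneg[of k] by simp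
  qed (rule excess_nonneg excess_step)+
  then show ?thesis
    using summable_cmult_iff[of "1 / 2 :: real" "\<lambda>k. \<alpha> k * mean_grad_sq k"] by simp
qed

text \<open>The difference of squares factors into a sum bounded by \<open>2 B\<close> and a difference bounded by the
  Lipschitz constant times the displacement \<open>\<alpha> \<parallel>P g\<parallel>\<close> of the average.\<close>

lemma mean_grad_sq_step:
  "mean_grad_sq (Suc k) \<le> mean_grad_sq k + 2 * B * L * (measure M (space M) + S) * \<alpha> k"
proof -
  have "mean_grad_sq (Suc k) \<le> (\<integral>\<omega>. (norm (P (D (P (x k \<omega>)))))\<^sup>2
      + 2 * B * L * \<alpha> k * (1 + (norm (g k \<omega>))\<^sup>2) \<partial>M)"
    unfolding mean_grad_sq_def
  proof (rule integral_mono)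
    fix \<omega> assume \<omega>: "\<omega> \<in> space M"
    define p where "p = norm (P (D (P (x k \<omega>))))"
    define q where "q = norm (P (D (P (x (Suc k) \<omega>))))"
    have B: "0 \<le> p" "p \<le> B" "0 \<le> q" "q \<le> B"
      unfolding p_def q_def by (auto intro: order_trans[OF norm_P_le D_bounded])
    have "q - p \<le> norm (P (D (P (x (Suc k) \<omega>)) - D (P (x k \<omega>))))"
      unfolding p_def q_def P_simps by (rule norm_triangle_ineq2)
    also have "\<dots> \<le> L * norm (P (x (Suc k) \<omega>) - P (x k \<omega>))"
      using norm_P_le D_lipschitz by (rule order_trans)
    also have "\<dots> \<le> L * (\<alpha> k * (1 + (norm (g k \<omega>))\<^sup>2))"
      unfolding P_recursion[OF \<omega>] using \<alpha>_pos[of k] L_nonneg norm_P_le[of "g k \<omega>"]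
        real_le_one_plus_sq[of "norm (g k \<omega>)"]
      by (intro mult_left_mono) (auto intro!: mult_left_mono)
    finally have d: "q - p \<le> L * (\<alpha> k * (1 + (norm (g k \<omega>))\<^sup>2))" .
    have "q\<^sup>2 - p\<^sup>2 = (q + p) * (q - p)" by (simp add: power2_eq_square algebra_simps)
    also have "\<dots> \<le> (q + p) * (L * (\<alpha> k * (1 + (norm (g k \<omega>))\<^sup>2)))"
      using d B by (intro mult_left_mono) auto
    also have "\<dots> \<le> (2 * B) * (L * (\<alpha> k * (1 + (norm (g k \<omega>))\<^sup>2)))"
      using B \<alpha>_pos[of k] L_nonneg by (intro mult_right_mono) auto
    finally show "(norm (P (D (P (x (Suc k) \<omega>)))))\<^sup>2 \<le> (norm (P (D (P (x k \<omega>)))))\<^sup>2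
      + 2 * B * L * \<alpha> k * (1 + (norm (g k \<omega>))\<^sup>2)"
      by (simp add: p_def q_def algebra_simps)
  qed (intro integrable_averaged_gradients Bochner_Integration.integrable_add
        integrable_mult_right g_square_integrable integrable_const)+
  also have "\<dots> = mean_grad_sq k
      + 2 * B * L * \<alpha> k * (measure M (space M) + (\<integral>\<omega>. (norm (g k \<omega>))\<^sup>2 \<partial>M))"
    unfolding mean_grad_sq_def
    using integrable_averaged_gradients(1)[of k] g_square_integrable[of k] by simp
  also have "\<dots> \<le> mean_grad_sq k + 2 * B * L * \<alpha> k * (measure M (space M) + S)"
    using B_nonneg L_nonneg \<alpha>_pos[of k] g_second_moment[of k]
    by (intro add_left_mono mult_left_mono) auto
  finally show ?thesis by (simp add: mult_ac)
qed

lemma mean_grad_sq_null: "mean_grad_sq \<longlonglongrightarrow> 0"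
proof (rule slowly_varying_weighted_summable_null[OF mean_grad_sq_nonneg less_imp_le[OF \<alpha>_pos]
      mean_grad_sq_step _ summable_mean_grad_sq \<alpha>_diverges \<alpha>_sq_summable])
  have "0 \<le> (\<integral>\<omega>. (norm (g 0 \<omega>))\<^sup>2 \<partial>M)" by simp
  then have "0 \<le> S" using g_second_moment[of 0] by linarith
  then show "0 \<le> 2 * B * L * (measure M (space M) + S)"
    using B_nonneg L_nonneg by simp
qed

theorem averaged_gradient_null: "(\<lambda>k. \<integral>\<omega>. (norm (P (D (x k \<omega>))))\<^sup>2 \<partial>M) \<longlonglongrightarrow> 0"
proof (rule tendsto_sandwich[where f = "\<lambda>_. 0"])
  show "(\<lambda>k. 2 * L\<^sup>2 * disagreement k + 2 * mean_grad_sq k) \<longlonglongrightarrow> 0"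
    by (rule tendsto_eq_intros disagreement_null mean_grad_sq_null refl)+ simp
  have "(\<integral>\<omega>. (norm (P (D (x k \<omega>))))\<^sup>2 \<partial>M) \<le> 2 * L\<^sup>2 * disagreement k + 2 * mean_grad_sq k" for k
  proof -
    have "(\<integral>\<omega>. (norm (P (D (x k \<omega>))))\<^sup>2 \<partial>M)
      \<le> (\<integral>\<omega>. 2 * L\<^sup>2 * (norm (x k \<omega> - P (x k \<omega>)))\<^sup>2 + 2 * (norm (P (D (P (x k \<omega>)))))\<^sup>2 \<partial>M)"
    proof (rule integral_mono)
      fix \<omega>
      let ?u = "P (D (x k \<omega>) - D (P (x k \<omega>)))" and ?v = "P (D (P (x k \<omega>)))"
      have "norm ?u \<le> L * norm (x k \<omega> - P (x k \<omega>))"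
        using norm_P_le D_lipschitz by (rule order_trans)
      then have "(norm ?u)\<^sup>2 \<le> L\<^sup>2 * (norm (x k \<omega> - P (x k \<omega>)))\<^sup>2"
        unfolding power_mult_distrib[symmetric] by (rule power_mono) simp
      moreover have "P (D (x k \<omega>)) = ?u + ?v" by (simp add: P_simps)
      ultimately show "(norm (P (D (x k \<omega>))))\<^sup>2
        \<le> 2 * L\<^sup>2 * (norm (x k \<omega> - P (x k \<omega>)))\<^sup>2 + 2 * (norm (P (D (P (x k \<omega>)))))\<^sup>2"
        using norm_add_sq_le[of ?u ?v] by simp
    qed (intro integrable_averaged_gradients Bochner_Integration.integrable_add
          integrable_mult_right integrable_disagreement)+
    also have "\<dots> = 2 * L\<^sup>2 * disagreement k + 2 * mean_grad_sq k"
      unfolding disagreement_def mean_grad_sq_def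
      using integrable_disagreement[of k] integrable_averaged_gradients(1)[of k] by simp
    finally show ?thesis .
  qed
  then show "eventually (\<lambda>k. (\<integral>\<omega>. (norm (P (D (x k \<omega>))))\<^sup>2 \<partial>M)
      \<le> 2 * L\<^sup>2 * disagreement k + 2 * mean_grad_sq k) sequentially"
    by simp
qed (auto intro: always_eventually)

end

section \<open>Averaging and the graph Laplacian on stacked vectors\<close>

lemma kronecker_identity_mult:
  "(kronecker A (mat 1 :: real^'d^'d) *v u) $ (i, c) = (\<Sum>j\<in>UNIV. A $ i $ j * u $ (j, c))"
proof -
  have "(kronecker A (mat 1 :: real^'d^'d) *v u) $ (i, c)
      = (\<Sum>(j, e)\<in>UNIV \<times> UNIV. A $ i $ j * (if c = e then 1 else 0) * u $ (j, e))"
    by (simp add: kronecker_def matrix_vector_mult_def mat_def case_prod_beta)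
  also have "\<dots> = (\<Sum>j\<in>UNIV. \<Sum>e\<in>UNIV. A $ i $ j * (if c = e then 1 else 0) * u $ (j, e))"
    by (simp only: sum.cartesian_product)
  also have "\<dots> = (\<Sum>j\<in>UNIV. \<Sum>e\<in>UNIV. if c = e then A $ i $ j * u $ (j, e) else 0)"
    by (intro sum.cong refl) auto
  also have "\<dots> = (\<Sum>j\<in>UNIV. A $ i $ j * u $ (j, c))"
    by simp
  finally show ?thesis .
qed

lemma inner_stacked:
  "(u :: real^('n::finite \<times> 'd::finite)) \<bullet> v = (\<Sum>c\<in>UNIV. \<Sum>i\<in>UNIV. u $ (i, c) * v $ (i, c))"
proof -
  have "u \<bullet> v = (\<Sum>(i, c)\<in>UNIV \<times> UNIV. u $ (i, c) * v $ (i, c))"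
    by (simp add: inner_vec_def case_prod_beta)
  also have "\<dots> = (\<Sum>i\<in>UNIV. \<Sum>c\<in>UNIV. u $ (i, c) * v $ (i, c))"
    by (simp only: sum.cartesian_product)
  also have "\<dots> = (\<Sum>c\<in>UNIV. \<Sum>i\<in>UNIV. u $ (i, c) * v $ (i, c))"
    by (rule sum.swap)
  finally show ?thesis .
qed

text \<open>The orthogonal projection onto the vectors with identical blocks.\<close>

definition averaging :: "real^('n::finite \<times> 'd::finite) \<Rightarrow> real^('n \<times> 'd)" where
  "averaging u =
     (1 / real CARD('n)) *\<^sub>R (kronecker ((\<chi> i j. 1) :: real^'n^'n) (mat 1 :: real^'d^'d) *v u)"

definition consensus_operator ::
    "'n pair_pre_digraph \<Rightarrow> real^('n::finite \<times> 'd::finite) \<Rightarrow> real^('n \<times> 'd)" where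
  "consensus_operator G u = kronecker (laplacian G) (mat 1 :: real^'d^'d) *v u"

lemma averaging_component:
  "averaging (u :: real^('n::finite \<times> 'd::finite)) $ (i, c) = (\<Sum>j\<in>UNIV. u $ (j, c)) / real CARD('n)"
  by (simp add: averaging_def kronecker_identity_mult)

lemma linear_averaging: "linear averaging"
  unfolding averaging_def[abs_def]
  by (intro linear_compose_scale_right matrix_vector_mul_linear)

lemma averaging_idem: "averaging (averaging u) = averaging u"
  by (simp add: vec_eq_iff averaging_component)

lemma averaging_sym: "averaging u \<bullet> v = u \<bullet> averaging v"
proof -
  have "averaging u \<bullet> v = (\<Sum>c\<in>UNIV. (\<Sum>j\<in>UNIV. u $ (j, c)) * (\<Sum>i\<in>UNIV. v $ (i, c)) / real CARD('a))"
    unfolding inner_stacked averaging_component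
    by (intro sum.cong refl) (simp add: sum_distrib_left[symmetric] sum_distrib_right[symmetric] sum_divide_distrib[symmetric])
  also have "\<dots> = u \<bullet> averaging v"
    unfolding inner_stacked averaging_component
    by (intro sum.cong refl) (simp add: sum_distrib_left[symmetric] sum_distrib_right[symmetric] sum_divide_distrib[symmetric])
  finally show ?thesis .
qed

lemma linear_consensus_operator: "linear (consensus_operator G)"
  unfolding consensus_operator_def[abs_def] by (rule matrix_vector_mul_linear)

text \<open>Loops contribute equally to the degree and to the adjacency matrix, so they cancel.\<close>

lemma consensus_operator_component:
  "consensus_operator G u $ (i, c)
     = (\<Sum>j\<in>UNIV. adjacency_matrix G $ i $ j * (u $ (i, c) - u $ (j, c)))"
proof -
  have "consensus_operator G u $ (i, c) = (\<Sum>j\<in>UNIV.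
      (if i = j then (\<Sum>k\<in>UNIV. adjacency_matrix G $ i $ k) * u $ (j, c) else 0)
      - adjacency_matrix G $ i $ j * u $ (j, c))"
    unfolding consensus_operator_def kronecker_identity_mult
    by (intro sum.cong refl)
      (simp add: laplacian_def diag_matrix_def matrix_vector_mult_def left_diff_distrib)
  also have "\<dots> = (\<Sum>k\<in>UNIV. adjacency_matrix G $ i $ k) * u $ (i, c)
      - (\<Sum>j\<in>UNIV. adjacency_matrix G $ i $ j * u $ (j, c))"
    by (simp add: sum_subtractf)
  finally show ?thesis
    by (simp add: right_diff_distrib sum_subtractf sum_distrib_right)
qed

lemma mixing_step:
  "kronecker (mixing_matrix G b) (mat 1 :: real^'d^'d) *v u
     = u - b *\<^sub>R consensus_operator G (u :: real^('n::finite \<times> 'd::finite))"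
proof -
  have "(kronecker (mixing_matrix G b) (mat 1 :: real^'d^'d) *v u) $ (i, c)
      = (u - b *\<^sub>R consensus_operator G u) $ (i, c)" for i c
  proof -
    have "(kronecker (mixing_matrix G b) (mat 1 :: real^'d^'d) *v u) $ (i, c)
        = (\<Sum>j\<in>UNIV. (if i = j then u $ (j, c) else 0) - b * (laplacian G $ i $ j * u $ (j, c)))"
      unfolding kronecker_identity_mult
      by (intro sum.cong refl) (simp add: mixing_matrix_def mat_def left_diff_distrib)
    also have "\<dots> = u $ (i, c) - b * (\<Sum>j\<in>UNIV. laplacian G $ i $ j * u $ (j, c))"
      by (simp add: sum_subtractf sum_distrib_left)
    finally show ?thesis
      by (simp add: consensus_operator_def kronecker_identity_mult)
  qed
  then show ?thesis by (simp add: vec_eq_iff)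
qed

lemma consensus_operator_averaging: "consensus_operator G (averaging u) = 0"
  by (simp add: vec_eq_iff consensus_operator_component averaging_component)

lemma adjacency_matrix_symmetric:
  assumes "pair_pseudo_graph G"
  shows "adjacency_matrix G $ i $ j = adjacency_matrix G $ j $ i"
proof -
  interpret pair_pseudo_graph G by fact
  have "sym (parcs G)"
    using pair_sym_arcs by (simp add: symmetric_def)
  then show ?thesis
    by (auto simp: adjacency_matrix_def dest: symD)
qed

lemma averaging_consensus_operator:
  assumes "pair_pseudo_graph G"
  shows "averaging (consensus_operator G u) = 0"
proof -
  let ?a = "\<lambda>i j. adjacency_matrix G $ i $ j"
  have "(\<Sum>i\<in>UNIV. consensus_operator G u $ (i, c)) = 0" for c
  proof -
    have "(\<Sum>i\<in>UNIV. \<Sum>j\<in>UNIV. ?a i j * u $ (j, c)) = (\<Sum>j\<in>UNIV. \<Sum>i\<in>UNIV. ?a i j * u $ (j, c))"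
      by (rule sum.swap)
    also have "\<dots> = (\<Sum>i\<in>UNIV. \<Sum>j\<in>UNIV. ?a i j * u $ (i, c))"
      using adjacency_matrix_symmetric[OF assms] by (intro sum.cong refl) simp
    finally show ?thesis
      by (simp add: consensus_operator_component right_diff_distrib sum_subtractf)
  qed
  then show ?thesis
    by (simp add: vec_eq_iff averaging_component)
qed

text \<open>The Dirichlet form of the graph. Exchanging the two summation indices and using the symmetry of
  the adjacency matrix gives a second expression for the left-hand side; the two add up to the squares.\<close>

lemma inner_consensus_operator:
  assumes "pair_pseudo_graph G"
  shows "u \<bullet> consensus_operator G u
    = (\<Sum>c\<in>UNIV. \<Sum>i\<in>UNIV. \<Sum>j\<in>UNIV. adjacency_matrix G $ i $ j * (u $ (i, c) - u $ (j, c))\<^sup>2) / 2"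
proof -
  let ?a = "\<lambda>i j. adjacency_matrix G $ i $ j"
  have half: "(\<Sum>i\<in>UNIV. \<Sum>j\<in>UNIV. ?a i j * (u $ (i, c) - u $ (j, c))\<^sup>2)
      = 2 * (\<Sum>i\<in>UNIV. u $ (i, c) * consensus_operator G u $ (i, c))" for c
  proof -
    let ?X = "\<Sum>i\<in>UNIV. \<Sum>j\<in>UNIV. ?a i j * u $ (i, c) * (u $ (i, c) - u $ (j, c))"
    have X: "(\<Sum>i\<in>UNIV. u $ (i, c) * consensus_operator G u $ (i, c)) = ?X"
      by (simp add: consensus_operator_component sum_distrib_left mult_ac)
    have "?X = (\<Sum>j\<in>UNIV. \<Sum>i\<in>UNIV. ?a i j * u $ (i, c) * (u $ (i, c) - u $ (j, c)))"
      by (rule sum.swap)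
    also have "\<dots> = (\<Sum>i\<in>UNIV. \<Sum>j\<in>UNIV. ?a i j * u $ (j, c) * (u $ (j, c) - u $ (i, c)))"
      using adjacency_matrix_symmetric[OF assms] by (intro sum.cong refl) simp
    finally have "2 * ?X = ?X + (\<Sum>i\<in>UNIV. \<Sum>j\<in>UNIV. ?a i j * u $ (j, c) * (u $ (j, c) - u $ (i, c)))"
      by simp
    also have "\<dots> = (\<Sum>i\<in>UNIV. \<Sum>j\<in>UNIV. ?a i j * (u $ (i, c) - u $ (j, c))\<^sup>2)"
      unfolding sum.distrib[symmetric]
      by (intro sum.cong refl) (simp add: power2_eq_square algebra_simps)
    finally show ?thesis unfolding X by simp
  qed
  show ?thesis
    unfolding half inner_stacked by (simp add: sum_distrib_left[symmetric])
qed

lemma connected_graph_constant: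
  assumes G: "pverts G = UNIV" "Digraph_Component.connected (with_proj G)"
    and eq: "\<And>i j. (i, j) \<in> parcs G \<Longrightarrow> v i = v j"
  shows "v i = v j"
proof -
  have "(i, j) \<in> rtrancl_on UNIV ((arcs_ends (with_proj G))\<^sup>s)"
    using G unfolding connected_conv by simp
  then show ?thesis
  proof (induction rule: rtrancl_on_induct)
    case (step y z)
    have "arcs_ends (with_proj G) = parcs G"
      by (simp add: arcs_ends_def arc_to_ends_def)
    with step have "(y, z) \<in> parcs G \<or> (z, y) \<in> parcs G"
      by (auto simp: symcl_def)
    with step eq show ?case by metis
  qed simp
qed

text \<open>If the Dirichlet form vanishes, then the blocks agree along every arc, hence everywhere by
  connectedness, and a vector with identical blocks is its own average.\<close>

lemma consensus_operator_positive:
  fixes u :: "real^('n::finite \<times> 'd::finite)"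
  assumes G: "pair_pseudo_graph G" "pverts G = UNIV" "Digraph_Component.connected (with_proj G)"
    and u: "averaging u = 0" "u \<noteq> 0"
  shows "0 < u \<bullet> consensus_operator G u"
proof -
  let ?t = "\<lambda>c i j. adjacency_matrix G $ i $ j * (u $ (i, c) - u $ (j, c))\<^sup>2"
  have nonneg: "0 \<le> ?t c i j" for c i j
    by (simp add: adjacency_matrix_def)
  have "(\<Sum>c\<in>UNIV. \<Sum>i\<in>UNIV. \<Sum>j\<in>UNIV. ?t c i j) \<noteq> 0"
  proof
    assume "(\<Sum>c\<in>UNIV. \<Sum>i\<in>UNIV. \<Sum>j\<in>UNIV. ?t c i j) = 0"
    then have zero: "?t c i j = 0" for c i j
      by (simp add: sum_nonneg_eq_0_iff sum_nonneg nonneg del: mult_eq_0_iff)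
    then have "u $ (i, c) = u $ (j, c)" if "(i, j) \<in> parcs G" for c i j
      using zero[of i j c] that by (simp add: adjacency_matrix_def)
    then have const: "u $ (i, c) = u $ (j, c)" for c i j
      by (rule connected_graph_constant[OF G(2,3), of "\<lambda>i. u $ (i, c)"])
    have "u $ (i, c) = 0" for i c
    proof -
      have "(\<Sum>j\<in>UNIV. u $ (j, c)) = (\<Sum>j\<in>(UNIV::'n set). u $ (i, c))"
        using const by (intro sum.cong refl)
      then have "averaging u $ (i, c) = u $ (i, c)"
        by (simp add: averaging_component)
      then show ?thesis using u by simp
    qed
    then have "u = 0" by (auto simp: vec_eq_iff)
    with u show False by simp
  qed
  moreover have "0 \<le> (\<Sum>c\<in>UNIV. \<Sum>i\<in>UNIV. \<Sum>j\<in>UNIV. ?t c i j)"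
    by (intro sum_nonneg nonneg)
  ultimately show ?thesis
    unfolding inner_consensus_operator[OF G(1)] by linarith
qed

text \<open>The constant is the minimum of the quadratic form on the unit sphere of the kernel, which is
  compact; homogeneity does the rest.\<close>

lemma positive_on_kernel_imp_coercive:
  fixes A Q :: "'a::euclidean_space \<Rightarrow> 'a"
  assumes A: "linear A" and Q: "linear Q"
    and pos: "\<And>u. Q u = 0 \<Longrightarrow> u \<noteq> 0 \<Longrightarrow> 0 < u \<bullet> A u"
  obtains \<kappa> where "0 < \<kappa>" "\<And>u. Q u = 0 \<Longrightarrow> \<kappa> * (norm u)\<^sup>2 \<le> u \<bullet> A u"
proof (cases "{u. Q u = 0} \<inter> sphere 0 1 = {}")
  case True
  have "u = 0" if "Q u = 0" for u
  proof (rule ccontr)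
    assume "u \<noteq> 0"
    then have "(1 / norm u) *\<^sub>R u \<in> {u. Q u = 0} \<inter> sphere 0 1"
      using that Q by (simp add: linear_scale)
    with True show False by blast
  qed
  then show ?thesis using that[of 1] by force
next
  case False
  have cA: "continuous_on UNIV A" and cQ: "continuous_on UNIV Q"
    using A Q by (auto intro: linear_continuous_on simp: linear_conv_bounded_linear)
  have "closed (Q -` {0})"
    using cQ by (intro continuous_closed_vimage) (auto simp: continuous_on_eq_continuous_at)
  then have "compact ({u. Q u = 0} \<inter> sphere 0 1)"
    by (intro closed_Int_compact) (auto simp: vimage_def)
  moreover have "continuous_on ({u. Q u = 0} \<inter> sphere 0 1) (\<lambda>u. u \<bullet> A u)"
    by (intro continuous_intros continuous_on_subset[OF cA]) auto
  ultimately obtain m where m: "m \<in> {u. Q u = 0} \<inter> sphere 0 1"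
    and min: "\<And>u. u \<in> {u. Q u = 0} \<inter> sphere 0 1 \<Longrightarrow> m \<bullet> A m \<le> u \<bullet> A u"
    using continuous_attains_inf[OF _ False, of "\<lambda>u. u \<bullet> A u"] by blast
  show ?thesis
  proof (rule that)
    show "0 < m \<bullet> A m" using m by (intro pos) auto
    fix u assume u: "Q u = 0"
    show "m \<bullet> A m * (norm u)\<^sup>2 \<le> u \<bullet> A u"
    proof (cases "u = 0")
      case nz: False
      have "m \<bullet> A m \<le> ((1 / norm u) *\<^sub>R u) \<bullet> A ((1 / norm u) *\<^sub>R u)"
        using u Q nz by (intro min) (simp add: linear_scale)
      also have "\<dots> = (u \<bullet> A u) / (norm u)\<^sup>2"
        using A by (simp add: linear_scale power2_eq_square)
      finally show ?thesis using nz by (simp add: field_simps)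
    qed (use A in \<open>simp add: linear_0\<close>)
  qed
qed

lemma consensus_operator_coercive:
  assumes "pair_pseudo_graph G" "pverts G = UNIV" "Digraph_Component.connected (with_proj G)"
  obtains \<kappa> where "0 < \<kappa>"
    "\<And>u :: real^('n::finite \<times> 'd::finite). averaging u = 0 \<Longrightarrow> \<kappa> * (norm u)\<^sup>2 \<le> u \<bullet> consensus_operator G u"
  using positive_on_kernel_imp_coercive[OF linear_consensus_operator[of G] linear_averaging
      consensus_operator_positive[OF assms]] by blast

section \<open>The gradient of the aggregate objective\<close>

lemma inner_stack: "h \<bullet> stack v = (\<Sum>i\<in>UNIV. block h i \<bullet> v i)"
proof -
  have "(\<Sum>i\<in>UNIV. block h i \<bullet> v i) = (\<Sum>i\<in>UNIV. \<Sum>c\<in>UNIV. h $ (i, c) * v i $ c)"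
    by (simp add: inner_vec_def block_def)
  also have "\<dots> = (\<Sum>c\<in>UNIV. \<Sum>i\<in>UNIV. h $ (i, c) * v i $ c)"
    by (rule sum.swap)
  finally show ?thesis
    by (simp add: inner_stacked stack_def)
qed

lemma block_stack [simp]: "block (stack v) i = v i"
  by (simp add: block_def stack_def vec_eq_iff)

lemma stack_diff: "stack u - stack v = stack (\<lambda>i. u i - v i)"
  by (simp add: stack_def vec_eq_iff)

lemma bounded_linear_block: "bounded_linear (\<lambda>w. block w i)"
  unfolding linear_conv_bounded_linear[symmetric]
  by (rule linearI) (simp_all add: block_def vec_eq_iff)

lemma norm_stack_le: "norm (stack v) \<le> (\<Sum>i\<in>UNIV. norm (v i))"
proof -
  have "norm (stack v) = L2_set (\<lambda>i. norm (v i)) UNIV"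
    unfolding norm_eq_sqrt_inner[of "stack v"] L2_set_def
    by (simp add: inner_stack power2_norm_eq_inner)
  also have "\<dots> \<le> (\<Sum>i\<in>UNIV. norm (v i))"
    by (rule L2_set_le_sum) simp
  finally show ?thesis .
qed

lemma norm_block_le: "norm (block w i) \<le> norm w"
proof -
  have "stack (block w) = w"
    by (simp add: stack_def block_def vec_eq_iff)
  then have "w \<bullet> w = (\<Sum>i\<in>UNIV. block w i \<bullet> block w i)"
    using inner_stack[of w "block w"] by simp
  moreover have "block w i \<bullet> block w i \<le> (\<Sum>i\<in>UNIV. block w i \<bullet> block w i)"
    by (rule member_le_sum) auto
  ultimately show ?thesis
    by (simp add: norm_le)
qed

lemma GDERIV_aggregate:
  fixes w :: "real^('n::finite \<times> 'd::finite)"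
  assumes "\<And>i. f i differentiable (at (block w i))"
  shows "GDERIV (aggregate f) w :> stack (\<lambda>i. grad (f i) (block w i))"
proof -
  have "((\<lambda>w. f i (block w i)) has_derivative (\<lambda>h. block h i \<bullet> grad (f i) (block w i))) (at w)" for i
    using has_derivative_compose[OF bounded_linear_imp_has_derivative[OF bounded_linear_block]]
      differentiable_imp_GDERIV_grad[OF assms[of i]]
    unfolding gderiv_def by blast
  then have "((\<lambda>w. \<Sum>i\<in>UNIV. f i (block w i)) has_derivative
      (\<lambda>h. \<Sum>i\<in>UNIV. block h i \<bullet> grad (f i) (block w i))) (at w)"
    by (rule has_derivative_sum)
  then show ?thesis
    unfolding gderiv_def aggregate_def[abs_def] inner_stack .
qed

lemma aggregate_gradient_Lipschitz:
  fixes f :: "'n::finite \<Rightarrow> real^'d::finite \<Rightarrow> real"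
  assumes diff: "\<And>i x. f i differentiable (at x)"
    and lip: "\<And>i x y. norm (grad (f i) x - grad (f i) y) \<le> L i * norm (x - y)" and L: "\<And>i. 0 \<le> L i"
  shows "norm (grad (aggregate f) u - grad (aggregate f) v) \<le> (\<Sum>i\<in>UNIV. L i) * norm (u - v)"
proof -
  have "norm (grad (aggregate f) u - grad (aggregate f) v)
      \<le> (\<Sum>i\<in>UNIV. norm (grad (f i) (block u i) - grad (f i) (block v i)))"
    unfolding grad_eqI[OF GDERIV_aggregate[OF diff]] stack_diff by (rule norm_stack_le)
  also have "\<dots> \<le> (\<Sum>i\<in>UNIV. L i * norm (u - v))"
  proof (rule sum_mono)
    fix i
    have "norm (block u i - block v i) \<le> norm (u - v)"
      using norm_block_le[of "u - v" i]
      by (simp add: linear_diff[OF bounded_linear.linear[OF bounded_linear_block]])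
    then show "norm (grad (f i) (block u i) - grad (f i) (block v i)) \<le> L i * norm (u - v)"
      using L by (intro order_trans[OF lip] mult_left_mono) auto
  qed
  finally show ?thesis by (simp add: sum_distrib_right)
qed

lemma aggregate_gradient_bounded:
  fixes f :: "'n::finite \<Rightarrow> real^'d::finite \<Rightarrow> real"
  assumes diff: "\<And>i x. f i differentiable (at x)"
    and lip: "\<And>i x y. \<bar>f i x - f i y\<bar> \<le> K i * norm (x - y)" and K: "\<And>i. 0 \<le> K i"
  shows "norm (grad (aggregate f) u) \<le> (\<Sum>i\<in>UNIV. K i)"
proof -
  have "norm (grad (aggregate f) u) \<le> (\<Sum>i\<in>UNIV. norm (grad (f i) (block u i)))"
    unfolding grad_eqI[OF GDERIV_aggregate[OF diff]] by (rule norm_stack_le)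
  also have "\<dots> \<le> (\<Sum>i\<in>UNIV. K i)"
    using norm_gradient_le_Lipschitz[OF differentiable_imp_GDERIV_grad[OF diff] lip K]
    by (intro sum_mono) blast
  finally show ?thesis .
qed

section \<open>Histories, conditional moments and localisation\<close>

text \<open>The part of the expectation over \<open>\<parallel>X\<parallel> > R\<close> is at most \<open>K\<close> times the probability of that event,
  uniformly in \<open>k\<close>, and this probability tends to \<open>0\<close> with growing \<open>R\<close> by continuity of the measure.\<close>

lemma (in prob_space) expectation_null_by_localisation:
  fixes \<phi> :: "nat \<Rightarrow> 'a \<Rightarrow> real" and X :: "'a \<Rightarrow> 'b::real_normed_vector"
  assumes [measurable]: "\<And>k. \<phi> k \<in> borel_measurable M" "(\<lambda>\<omega>. norm (X \<omega>)) \<in> borel_measurable M"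
    and nonneg: "\<And>k \<omega>. 0 \<le> \<phi> k \<omega>" and bound: "\<And>k \<omega>. \<phi> k \<omega> \<le> K"
    and local: "\<And>R. (\<lambda>k. \<integral>\<omega>. indicator {\<omega> \<in> space M. norm (X \<omega>) \<le> R} \<omega> * \<phi> k \<omega> \<partial>M) \<longlonglongrightarrow> 0"
  shows "(\<lambda>k. expectation (\<phi> k)) \<longlonglongrightarrow> 0"
proof -
  define A where "A r = {\<omega> \<in> space M. norm (X \<omega>) \<le> real r}" for r :: nat
  have A [measurable]: "A r \<in> sets M" for r
    unfolding A_def by measurable
  have K: "0 \<le> K"
    using nonneg bound order_trans by blast
  have union: "(\<Union>r. A r) = space M"
    unfolding A_def using real_arch_simple by auto
  have "(\<lambda>r. measure M (A r)) \<longlonglongrightarrow> measure M (\<Union>r. A r)"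
    by (rule finite_Lim_measure_incseq) (auto simp: incseq_def A_def)
  then have "(\<lambda>r. prob (A r)) \<longlonglongrightarrow> 1"
    unfolding union by (simp add: prob_space)
  then have "(\<lambda>r. K * (1 - prob (A r))) \<longlonglongrightarrow> K * (1 - 1)"
    by (intro tendsto_intros)
  then have tail: "(\<lambda>r. K * (1 - prob (A r))) \<longlonglongrightarrow> 0"
    by simp
  have int: "integrable M (\<phi> k)" for k
    using nonneg bound by (intro integrable_const_bound[where B = K]) auto
  have split: "expectation (\<phi> k) \<le> (\<integral>\<omega>. indicator (A r) \<omega> * \<phi> k \<omega> \<partial>M) + K * (1 - prob (A r))" for k r
  proof -
    have intA: "integrable M (\<lambda>\<omega>. indicator (A r) \<omega> * \<phi> k \<omega>)"
      by (intro integrable_real_mult_indicator[unfolded mult.commute[of _ "indicator _ _"]] A int)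
    have int1: "integrable M (\<lambda>\<omega>. K * indicator (space M - A r) \<omega> :: real)"
      using K by (intro integrable_const_bound[where B = K]) (auto simp: indicator_def)
    have "expectation (\<phi> k) \<le> (\<integral>\<omega>. indicator (A r) \<omega> * \<phi> k \<omega> + K * indicator (space M - A r) \<omega> \<partial>M)"
      using bound by (intro integral_mono int Bochner_Integration.integrable_add intA int1)
        (auto simp: indicator_def)
    also have "\<dots> = (\<integral>\<omega>. indicator (A r) \<omega> * \<phi> k \<omega> \<partial>M) + K * prob (space M - A r)"
      by (subst Bochner_Integration.integral_add[OF intA int1]) simp
    finally show ?thesis by (simp add: prob_compl)
  qed
  show ?thesis
  proof (rule order_tendstoI)
    fix y :: real assume y: "y < 0"
    have "0 \<le> expectation (\<phi> k)" for k
      using nonneg by (rule Bochner_Integration.integral_nonneg)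
    with y show "eventually (\<lambda>k. y < expectation (\<phi> k)) sequentially"
      by (intro always_eventually allI) (rule less_le_trans)
  next
    fix y :: real assume y: "0 < y"
    then have "eventually (\<lambda>r. K * (1 - prob (A r)) < y / 2) sequentially"
      using tail by (intro order_tendstoD(2)) auto
    then obtain r where r: "K * (1 - prob (A r)) < y / 2"
      by (auto simp: eventually_sequentially)
    have "eventually (\<lambda>k. (\<integral>\<omega>. indicator (A r) \<omega> * \<phi> k \<omega> \<partial>M) < y / 2) sequentially"
      using local[of "real r"] y unfolding A_def by (intro order_tendstoD(2)) auto
    then show "eventually (\<lambda>k. expectation (\<phi> k) < y) sequentially"
    proof eventually_elim
      case (elim k)
      then show ?case using split[of k r] r by linarith
    qed
  qed
qed

lemma history_algebra_subalgebra:
  assumes "\<And>i. w i \<in> borel_measurable M"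
  shows "subalgebra M (history_algebra M w k)"
proof -
  have "(\<Union>i\<le>k. {w i -` B \<inter> space M | B. B \<in> sets borel}) \<subseteq> sets M"
    using assms by (auto intro: measurable_sets)
  then show ?thesis
    unfolding subalgebra_def history_algebra_def
    by (simp add: sets_measure_of_conv sets.sigma_sets_subset space_measure_of_conv)
qed

lemma history_algebra_measurable:
  assumes "i \<le> k"
  shows "w i \<in> borel_measurable (history_algebra M w k)"
proof (rule measurableI)
  fix B :: "'b set" assume "B \<in> sets borel"
  then have "w i -` B \<inter> space M \<in> (\<Union>i\<le>k. {w i -` B \<inter> space M | B. B \<in> sets borel})"
    using assms by blast
  moreover have "(\<Union>i\<le>k. {w i -` B \<inter> space M | B. B \<in> sets borel}) \<subseteq> Pow (space M)"
    by auto
  ultimately show "w i -` B \<inter> space (history_algebra M w k) \<in> sets (history_algebra M w k)"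
    unfolding history_algebra_def by (simp add: space_measure_of_conv)
qed simp

text \<open>Componentwise, this is the defining property of the conditional expectation tested against a
  bounded function. Square integrability of \<open>X\<close> provides the integrability that the scalar result
  asks for.\<close>

lemma (in prob_space) integral_inner_vec_cond_exp:
  fixes X Y Z :: "'a \<Rightarrow> real^'b"
  assumes sub: "subalgebra M H"
    and Z [measurable]: "Z \<in> borel_measurable H" and Z_bound: "\<And>\<omega>. norm (Z \<omega>) \<le> K"
    and [measurable]: "X \<in> borel_measurable M" "Y \<in> borel_measurable M"
    and X_sq: "integrable M (\<lambda>\<omega>. (norm (X \<omega>))\<^sup>2)"
    and cond: "AE \<omega> in M. vec_cond_exp M H X \<omega> = Y \<omega>"
  shows "(\<integral>\<omega>. Z \<omega> \<bullet> X \<omega> \<partial>M) = (\<integral>\<omega>. Z \<omega> \<bullet> Y \<omega> \<partial>M)"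
proof -
  interpret H: finite_measure_subalgebra M H
    by unfold_locales (rule sub)
  have ZM [measurable]: "Z \<in> borel_measurable M"
    by (rule measurable_from_subalg[OF sub Z])
  have component [measurable]: "(\<lambda>v :: real^'b. v $ c) \<in> borel_measurable borel" for c
    by (intro borel_measurable_continuous_onI continuous_intros)
  have int: "integrable M (\<lambda>\<omega>. Z \<omega> $ c * X \<omega> $ c)" for c
  proof (rule Bochner_Integration.integrable_bound)
    show "integrable M (\<lambda>\<omega>. K * (1 + (norm (X \<omega>))\<^sup>2))"
      by (intro integrable_mult_right Bochner_Integration.integrable_add X_sq integrable_const)
    show "AE \<omega> in M. norm (Z \<omega> $ c * X \<omega> $ c) \<le> norm (K * (1 + (norm (X \<omega>))\<^sup>2))"
    proof (rule AE_I2)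
      fix \<omega>
      have "\<bar>X \<omega> $ c\<bar> \<le> norm (X \<omega>)" by (rule component_le_norm_cart)
      also have "\<dots> \<le> 1 + (norm (X \<omega>))\<^sup>2"
        by (rule real_le_one_plus_sq)
      finally have "\<bar>Z \<omega> $ c\<bar> * \<bar>X \<omega> $ c\<bar> \<le> K * (1 + (norm (X \<omega>))\<^sup>2)"
        using order_trans[OF component_le_norm_cart Z_bound]
        by (intro mult_mono) (auto intro: order_trans[OF norm_ge_zero Z_bound])
      then show "norm (Z \<omega> $ c * X \<omega> $ c) \<le> norm (K * (1 + (norm (X \<omega>))\<^sup>2))"
        unfolding real_norm_def abs_mult[of "Z \<omega> $ c"] by (rule order_trans[OF _ abs_ge_self])
    qed
  qed measurable
  have Zc: "(\<lambda>\<omega>. Z \<omega> $ c) \<in> borel_measurable H" for c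
    using Z component by (rule measurable_compose)
  have Xc: "(\<lambda>\<omega>. X \<omega> $ c) \<in> borel_measurable M" for c
    by measurable
  have AEc: "AE \<omega> in M. Z \<omega> $ c * real_cond_exp M H (\<lambda>\<omega>. X \<omega> $ c) \<omega> = Z \<omega> $ c * Y \<omega> $ c" for c
    using cond by eventually_elim (simp add: vec_cond_exp_def vec_eq_iff)
  have int': "integrable M (\<lambda>\<omega>. Z \<omega> $ c * Y \<omega> $ c)" for c
    using H.real_cond_exp_intg(1)[OF int Zc Xc]
    by (subst integrable_cong_AE[OF _ _ AEc, symmetric]) auto
  have "(\<integral>\<omega>. Z \<omega> $ c * X \<omega> $ c \<partial>M) = (\<integral>\<omega>. Z \<omega> $ c * Y \<omega> $ c \<partial>M)" for c
  proof -
    have "(\<integral>\<omega>. Z \<omega> $ c * X \<omega> $ c \<partial>M) = (\<integral>\<omega>. Z \<omega> $ c * real_cond_exp M H (\<lambda>\<omega>. X \<omega> $ c) \<omega> \<partial>M)"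
      by (rule H.real_cond_exp_intg(2)[OF int Zc Xc, symmetric])
    also have "\<dots> = (\<integral>\<omega>. Z \<omega> $ c * Y \<omega> $ c \<partial>M)"
      by (rule integral_cong_AE[OF _ _ AEc]) auto
    finally show ?thesis .
  qed
  then show ?thesis
    by (simp add: inner_vec_def Bochner_Integration.integral_sum int int')
qed

lemma (in prob_space) second_moment_from_conditional_bound:
  fixes X :: "'a \<Rightarrow> 'b::real_normed_vector"
  assumes sub: "subalgebra M H"
    and [measurable]: "(\<lambda>\<omega>. norm (X \<omega>)) \<in> borel_measurable M" and "0 \<le> S"
    and cond: "AE \<omega> in M. nn_cond_exp M H (\<lambda>\<omega>. ennreal ((norm (X \<omega>))\<^sup>2)) \<omega> \<le> ennreal S"
  shows "integrable M (\<lambda>\<omega>. (norm (X \<omega>))\<^sup>2)" "(\<integral>\<omega>. (norm (X \<omega>))\<^sup>2 \<partial>M) \<le> S"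
proof -
  interpret H: finite_measure_subalgebra M H
    by unfold_locales (rule sub)
  have "(\<integral>\<^sup>+\<omega>. ennreal ((norm (X \<omega>))\<^sup>2) \<partial>M)
      = (\<integral>\<^sup>+\<omega>. 1 * nn_cond_exp M H (\<lambda>\<omega>. ennreal ((norm (X \<omega>))\<^sup>2)) \<omega> \<partial>M)"
    by (subst H.nn_cond_exp_intg) auto
  also have "\<dots> \<le> (\<integral>\<^sup>+\<omega>. ennreal S \<partial>M)"
    using cond by (intro nn_integral_mono_AE) simp
  also have "\<dots> = ennreal S"
    by (simp add: emeasure_space_1)
  finally have le: "(\<integral>\<^sup>+\<omega>. ennreal ((norm (X \<omega>))\<^sup>2) \<partial>M) \<le> ennreal S" .
  then have "(\<integral>\<^sup>+\<omega>. ennreal ((norm (X \<omega>))\<^sup>2) \<partial>M) < \<infinity>"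
    by (simp add: order_le_less_trans)
  then show int: "integrable M (\<lambda>\<omega>. (norm (X \<omega>))\<^sup>2)"
    by (intro integrableI_nonneg) auto
  show "(\<integral>\<omega>. (norm (X \<omega>))\<^sup>2 \<partial>M) \<le> S"
    using le \<open>0 \<le> S\<close> by (subst (asm) nn_integral_eq_integral[OF int]) auto
qed

lemma summable_inverse_power_step:
  assumes "c \<noteq> 0"
  shows "summable (\<lambda>k. c / (real k + 1) powr s) \<longleftrightarrow> 1 < s"
proof -
  have "summable (\<lambda>k. c / (real k + 1) powr s) \<longleftrightarrow> summable (\<lambda>k. c * real (k + 1) powr - s)"
    by (simp add: powr_minus divide_inverse add.commute)
  also have "\<dots> \<longleftrightarrow> summable (\<lambda>k. c * real k powr - s)"
    by (rule summable_iff_shift[where f = "\<lambda>k. c * real k powr - s"])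
  also have "\<dots> \<longleftrightarrow> summable (\<lambda>k. real k powr - s)"
    using assms by (simp add: summable_cmult_iff)
  also have "\<dots> \<longleftrightarrow> 1 < s"
    by (simp add: summable_real_powr_iff)
  finally show ?thesis .
qed

section \<open>Convergence of the averaged gradient\<close>

theorem theorem5:
  fixes M :: "'w measure"
    and G :: "'n::finite pair_pre_digraph"
    and loss :: "real^'d::finite \<Rightarrow> 'x \<Rightarrow> real"
    and m :: "'n \<Rightarrow> nat"
    and data :: "'n \<Rightarrow> nat \<Rightarrow> 'x"
    and f :: "'n \<Rightarrow> real^'d \<Rightarrow> real"
    and F :: "real^('n \<times> 'd) \<Rightarrow> real"
    and g :: "nat \<Rightarrow> 'n \<Rightarrow> real^'d \<Rightarrow> 'y \<Rightarrow> real^'d"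
    and \<xi> :: "nat \<Rightarrow> 'w \<Rightarrow> 'n \<Rightarrow> 'y"
    and w dir :: "nat \<Rightarrow> 'w \<Rightarrow> real^('n \<times> 'd)"
    and \<alpha> \<beta> :: "nat \<Rightarrow> real"
    and a b \<delta>\<^sub>1 \<delta>\<^sub>2 :: real
  assumes prob: "prob_space M"
    and m_pos: "\<forall>i. m i > 0"
    and f_eq: "f = local_objective loss m data"
    and F_eq: "F = aggregate f"
    and dir_eq: "\<forall>k \<omega>. dir k \<omega> = stacked_direction g k (w k \<omega>) (\<xi> k \<omega>)"
    and init_rv: "w 0 \<in> borel_measurable M"
    and dir_rv: "\<forall>k. dir k \<in> borel_measurable M"
    and iteration: "\<forall>k. \<forall>\<omega>\<in>space M. w (Suc k) \<omega> =
          kronecker (mixing_matrix G (\<beta> k)) (mat 1 :: real^'d^'d) *v w k \<omega> - \<alpha> k *\<^sub>R dir k \<omega>"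
    and A1: "\<forall>i. (\<forall>x. f i differentiable (at x)) \<and>
          (\<exists>L0>0. \<exists>L>0.
             (\<forall>x y. \<bar>f i x - f i y\<bar> \<le> L0 * norm (x - y)) \<and>
             (\<forall>x y. norm (grad (f i) x - grad (f i) y) \<le> L * norm (x - y)))"
    and A2: "\<exists>Finf. \<forall>x. Finf \<le> F x"
    and A3: "\<forall>k. \<alpha> k = a / (real k + 1) powr \<delta>\<^sub>2" "\<forall>k. \<beta> k = b / (real k + 1) powr \<delta>\<^sub>1"
          "a > 0" "b > 0" "0 < 3 * \<delta>\<^sub>1" "3 * \<delta>\<^sub>1 < \<delta>\<^sub>2" "\<delta>\<^sub>2 \<le> 1" "\<delta>\<^sub>1 + \<delta>\<^sub>2 > 1" "\<delta>\<^sub>2 > 1 / 2"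
    and A4: "pair_pseudo_graph G" "pverts G = UNIV" "Digraph_Component.connected (with_proj G)"
    and A5: "alg_multiplicity (complex_matrix (mixing_matrix G b)) 1 = 1"
          "mixing_matrix G b *v 1 = 1"
          "\<forall>z. eigenvalue (complex_matrix (mixing_matrix G b)) z \<and> z \<noteq> 1 \<longrightarrow> cmod z < 1"
          "b * sigma_max (laplacian G) < 1"
    and A6: "\<forall>k. AE \<omega> in M.
          vec_cond_exp M (history_algebra M w k) (dir k) \<omega> = grad F (w k \<omega>)"
    and A7: "\<exists>\<mu>\<^sub>1\<ge>0. \<exists>\<mu>\<^sub>2\<ge>0. \<forall>k. AE \<omega> in M.
          nn_cond_exp M (history_algebra M w k) (\<lambda>\<omega>'. ennreal ((norm (dir k \<omega>'))\<^sup>2)) \<omega>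
            \<le> ennreal (\<mu>\<^sub>1 + \<mu>\<^sub>2 * (norm (grad F (w k \<omega>)))\<^sup>2)"
    and A8: "\<forall>i. twice_cont_differentiable (f i) \<and>
          (\<exists>LH. \<forall>x y. matrix_norm2 (hessian (f i) x - hessian (f i) y) \<le> LH * norm (x - y))"
  shows "(\<lambda>k. prob_space.expectation M (\<lambda>\<omega>. (norm (avg_grad f (w k \<omega>)))\<^sup>2)) \<longlonglongrightarrow> 0"
proof -
  interpret prob_space M by (rule prob)
  have diff: "f i differentiable (at u)" for i u
    using A1 by blast
  obtain K\<^sub>0 where K0: "\<And>i. 0 \<le> K\<^sub>0 i" "\<And>i x y. \<bar>f i x - f i y\<bar> \<le> K\<^sub>0 i * norm (x - y)"
    using A1 by (metis less_imp_le)
  obtain L where L: "\<And>i. 0 \<le> L i"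
    "\<And>i x y. norm (grad (f i) x - grad (f i) y) \<le> L i * norm (x - y)"
    using A1 by (metis less_imp_le)
  define B where "B = (\<Sum>i\<in>UNIV. K\<^sub>0 i)"
  define D where "D = grad F"
  have gradient: "GDERIV F u :> D u" for u
  proof -
    have "GDERIV F u :> stack (\<lambda>i. grad (f i) (block u i))"
      unfolding F_eq by (rule GDERIV_aggregate) (rule diff)
    then show ?thesis
      unfolding D_def by (simp add: grad_eqI)
  qed
  have D_bound: "norm (D u) \<le> B" for u
    unfolding D_def F_eq B_def by (rule aggregate_gradient_bounded) (fact diff K0)+
  have D_lipschitz: "norm (D u - D v) \<le> sum L UNIV * norm (u - v)" for u v
    unfolding D_def F_eq by (rule aggregate_gradient_Lipschitz) (fact diff L)+
  have D_measurable [measurable]: "D \<in> borel_measurable borel"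
    using D_lipschitz L(1)
    by (intro borel_measurable_continuous_onI lipschitz_on_continuous_on[of "sum L UNIV"])
      (auto intro!: lipschitz_onI sum_nonneg simp: dist_norm)
  have operators_measurable [measurable]:
    "(averaging :: real^('n \<times> 'd) \<Rightarrow> _) \<in> borel_measurable borel"
    "(consensus_operator G :: real^('n \<times> 'd) \<Rightarrow> _) \<in> borel_measurable borel"
    using linear_averaging linear_consensus_operator[of G]
    by (auto intro!: borel_measurable_continuous_onI linear_continuous_on
        simp: linear_conv_bounded_linear)
  obtain F\<^sub>0 where F0: "\<And>u. F\<^sub>0 \<le> F u"
    using A2 by blast
  obtain \<kappa> where \<kappa>: "0 < \<kappa>"
    "\<And>u :: real^('n \<times> 'd). averaging u = 0 \<Longrightarrow> \<kappa> * (norm u)\<^sup>2 \<le> u \<bullet> consensus_operator G u"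
    using consensus_operator_coercive[OF A4] by blast

  have recursion: "w (Suc k) \<omega> = w k \<omega> - \<beta> k *\<^sub>R consensus_operator G (w k \<omega>) - \<alpha> k *\<^sub>R dir k \<omega>"
    if "\<omega> \<in> space M" for k \<omega>
    using iteration that by (simp add: mixing_step)
  have dir_measurable [measurable]: "dir k \<in> borel_measurable M" for k
    using dir_rv by blast
  have w_measurable [measurable]: "w k \<in> borel_measurable M" for k
  proof (induction k)
    case (Suc k)
    note Suc [measurable]
    have "(\<lambda>\<omega>. w k \<omega> - \<beta> k *\<^sub>R consensus_operator G (w k \<omega>) - \<alpha> k *\<^sub>R dir k \<omega>) \<in> borel_measurable M"
      by measurable
    then show ?case
      by (subst measurable_cong[OF recursion]) auto
  qed (rule init_rv)
  note sub = history_algebra_subalgebra[OF w_measurable]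

  obtain \<mu>\<^sub>1 \<mu>\<^sub>2 where \<mu>: "0 \<le> \<mu>\<^sub>1" "0 \<le> \<mu>\<^sub>2"
    "\<And>k. AE \<omega> in M. nn_cond_exp M (history_algebra M w k) (\<lambda>\<omega>'. ennreal ((norm (dir k \<omega>'))\<^sup>2)) \<omega>
       \<le> ennreal (\<mu>\<^sub>1 + \<mu>\<^sub>2 * (norm (D (w k \<omega>)))\<^sup>2)"
    using A7 unfolding D_def by blast
  define S where "S = \<mu>\<^sub>1 + \<mu>\<^sub>2 * B\<^sup>2"
  have "0 \<le> S" using \<mu> by (simp add: S_def)
  have S_bound: "AE \<omega> in M. nn_cond_exp M (history_algebra M w k) (\<lambda>\<omega>'. ennreal ((norm (dir k \<omega>'))\<^sup>2)) \<omega>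
      \<le> ennreal S" for k
    using \<mu>(3)[of k]
  proof eventually_elim
    case (elim \<omega>)
    have "\<mu>\<^sub>1 + \<mu>\<^sub>2 * (norm (D (w k \<omega>)))\<^sup>2 \<le> S"
      unfolding S_def using \<mu> D_bound by (intro add_left_mono mult_left_mono power_mono) auto
    then show ?case using elim ennreal_leI order_trans by blast
  qed
  have dir_sq: "integrable M (\<lambda>\<omega>. (norm (dir k \<omega>))\<^sup>2)" "(\<integral>\<omega>. (norm (dir k \<omega>))\<^sup>2 \<partial>M) \<le> S" for k
    using second_moment_from_conditional_bound[OF sub _ \<open>0 \<le> S\<close> S_bound] by auto

  have \<alpha>: "\<alpha> = (\<lambda>k. a / (real k + 1) powr \<delta>\<^sub>2)" and \<beta>: "\<beta> = (\<lambda>k. b / (real k + 1) powr \<delta>\<^sub>1)"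
    using A3 by auto
  \<comment> \<open>All step size conditions reduce to exponents: \<open>\<delta>\<^sub>2 > 3 / 4\<close> follows from \<open>\<delta>\<^sub>1 + \<delta>\<^sub>2 > 1\<close> and
    \<open>3 * \<delta>\<^sub>1 < \<delta>\<^sub>2\<close>, and then \<open>2 * \<delta>\<^sub>2 - \<delta>\<^sub>1 > 5 / 3 * \<delta>\<^sub>2 > 1\<close>.\<close>
  have \<alpha>_le: "\<alpha> k \<le> a / b * \<beta> k" for k
  proof -
    have "(real k + 1) powr \<delta>\<^sub>1 \<le> (real k + 1) powr \<delta>\<^sub>2"
      using A3 by (intro powr_mono) auto
    then show ?thesis
      using A3(3,4) by (simp add: \<alpha> \<beta> frac_le)
  qed
  have \<beta>_null: "\<beta> \<longlonglongrightarrow> 0"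
  proof -
    have "filterlim (\<lambda>k. real k + 1) at_top sequentially"
      by (rule filterlim_at_top_mono[OF filterlim_real_sequentially]) simp
    then have "(\<lambda>k. (real k + 1) powr - \<delta>\<^sub>1) \<longlonglongrightarrow> 0"
      using A3 by (intro tendsto_neg_powr) auto
    then have "(\<lambda>k. b * (real k + 1) powr - \<delta>\<^sub>1) \<longlonglongrightarrow> 0"
      by (rule tendsto_mult_right_zero)
    then show ?thesis
      by (simp add: \<beta> powr_minus divide_inverse)
  qed
  have ratio: "(\<lambda>k. (\<alpha> k)\<^sup>2 / \<beta> k) = (\<lambda>k. (a\<^sup>2 / b) / (real k + 1) powr (2 * \<delta>\<^sub>2 - \<delta>\<^sub>1))"
    by (rule ext) (simp add: \<alpha> \<beta> power_divide powr_diff powr_power)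
  have square: "(\<lambda>k. (\<alpha> k)\<^sup>2) = (\<lambda>k. a\<^sup>2 / (real k + 1) powr (2 * \<delta>\<^sub>2))"
    by (rule ext) (simp add: \<alpha> power_divide powr_power)

  have localised: "(\<lambda>k. \<integral>\<omega>. indicator {\<omega> \<in> space M. norm (w 0 \<omega>) \<le> R} \<omega>
      * (norm (averaging (D (w k \<omega>))))\<^sup>2 \<partial>M) \<longlonglongrightarrow> 0" for R
  proof -
    define A where "A = {\<omega> \<in> space M. norm (w 0 \<omega>) \<le> R}"
    have A [measurable]: "A \<in> sets M"
      unfolding A_def by measurable
    \<comment> \<open>Restricting the measure to \<open>A\<close> makes \<open>w 0\<close> bounded; unbiasedness survives because \<open>A\<close> lies in
      every history.\<close>
    define N where "N = density M (\<lambda>\<omega>. ennreal (indicator A \<omega>))"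
    have N_sets [measurable_cong]: "sets N = sets M" and N_space: "space N = space M"
      by (simp_all add: N_def)
    have N_integral: "(\<integral>\<omega>. h \<omega> \<partial>N) = (\<integral>\<omega>. indicator A \<omega> * h \<omega> \<partial>M)"
      if "h \<in> borel_measurable M" for h :: "'w \<Rightarrow> real"
      unfolding N_def using that by (subst integral_density) auto
    have N_integrable: "integrable N h \<longleftrightarrow> integrable M (\<lambda>\<omega>. indicator A \<omega> * h \<omega>)"
      if "h \<in> borel_measurable M" for h :: "'w \<Rightarrow> real"
      unfolding N_def using that by (subst integrable_density) auto
    have N_finite: "finite_measure N"
      by (rule finite_measureI) (simp add: N_def ennreal_indicator emeasure_restricted)
    have A_history: "A \<in> sets (history_algebra M w k)" for k
    proof -
      have "A = w 0 -` cball 0 R \<inter> space (history_algebra M w k)"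
        by (auto simp: A_def history_algebra_def space_measure_of_conv)
      then show ?thesis
        using measurable_sets[OF history_algebra_measurable[of 0 k w M], of "cball 0 R"] by simp
    qed
    interpret N: consensus_sgd N F D averaging "consensus_operator G" w dir \<alpha> \<beta>
      F\<^sub>0 B "sum L UNIV" S "a / b" \<kappa>
    proof (intro consensus_sgd.intro N_finite consensus_sgd_axioms.intro)
      show "integrable N (\<lambda>\<omega>. (norm (w 0 \<omega>))\<^sup>2)"
      proof (subst N_integrable)
        show "integrable M (\<lambda>\<omega>. indicator A \<omega> * (norm (w 0 \<omega>))\<^sup>2)"
          by (intro integrable_const_bound[where B = "R\<^sup>2"])
            (auto simp: A_def indicator_def intro!: power_mono)
      qed measurable
      show "integrable N (\<lambda>\<omega>. (norm (dir k \<omega>))\<^sup>2)" for k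
      proof (subst N_integrable)
        show "integrable M (\<lambda>\<omega>. indicator A \<omega> * (norm (dir k \<omega>))\<^sup>2)"
          using integrable_mult_indicator[OF A dir_sq(1)] by simp
      qed measurable
      show "(\<integral>\<omega>. (norm (dir k \<omega>))\<^sup>2 \<partial>N) \<le> S" for k
      proof (subst N_integral)
        have "(\<integral>\<omega>. indicator A \<omega> * (norm (dir k \<omega>))\<^sup>2 \<partial>M) \<le> (\<integral>\<omega>. (norm (dir k \<omega>))\<^sup>2 \<partial>M)"
          using integrable_mult_indicator[OF A dir_sq(1)]
          by (intro integral_mono dir_sq) (auto simp: indicator_def)
        then show "(\<integral>\<omega>. indicator A \<omega> * (norm (dir k \<omega>))\<^sup>2 \<partial>M) \<le> S"
          using dir_sq(2) by (rule order_trans)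
      qed measurable
      fix k and \<phi> :: "real^('n \<times> 'd) \<Rightarrow> real^('n \<times> 'd)"
      assume \<phi> [measurable]: "\<phi> \<in> borel_measurable borel" and "bounded (range \<phi>)"
      then obtain K where K: "\<And>u. norm (\<phi> u) \<le> K"
        by (auto simp: bounded_iff)
      have [measurable]: "w k \<in> borel_measurable (history_algebra M w k)"
        by (rule history_algebra_measurable) simp
      \<comment> \<open>The indicator of \<open>A\<close> is absorbed into the bounded test function.\<close>
      have "(\<integral>\<omega>. (indicator A \<omega> *\<^sub>R \<phi> (w k \<omega>)) \<bullet> dir k \<omega> \<partial>M)
          = (\<integral>\<omega>. (indicator A \<omega> *\<^sub>R \<phi> (w k \<omega>)) \<bullet> D (w k \<omega>) \<partial>M)"
      proof (rule integral_inner_vec_cond_exp[OF sub _ _ _ _ dir_sq(1)])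
        show "(\<lambda>\<omega>. indicator A \<omega> *\<^sub>R \<phi> (w k \<omega>)) \<in> borel_measurable (history_algebra M w k)"
          using A_history[of k] by measurable
        show "norm (indicator A \<omega> *\<^sub>R \<phi> (w k \<omega>)) \<le> K" for \<omega>
          using K order_trans[OF norm_ge_zero K] by (simp add: indicator_def)
        show "AE \<omega> in M. vec_cond_exp M (history_algebra M w k) (dir k) \<omega> = D (w k \<omega>)"
          using A6 unfolding D_def by blast
      qed measurable
      then show "(\<integral>\<omega>. \<phi> (w k \<omega>) \<bullet> dir k \<omega> \<partial>N) = (\<integral>\<omega>. \<phi> (w k \<omega>) \<bullet> D (w k \<omega>) \<partial>N)"
        by (subst (1 2) N_integral) auto
    next
      show "\<not> summable \<alpha>"
        unfolding \<alpha> using A3(3-) by (subst summable_inverse_power_step) auto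
      show "summable (\<lambda>k. (\<alpha> k)\<^sup>2)"
        unfolding square using A3(3-) by (subst summable_inverse_power_step) auto
      show "summable (\<lambda>k. (\<alpha> k)\<^sup>2 / \<beta> k)"
        unfolding ratio using A3(3-) by (subst summable_inverse_power_step) auto
      show "0 < \<alpha> k" "0 < \<beta> k" for k
        using A3 by simp_all
      show "w k \<in> borel_measurable N" "dir k \<in> borel_measurable N" for k
        by measurable
      show "w (Suc k) \<omega> = w k \<omega> - \<beta> k *\<^sub>R consensus_operator G (w k \<omega>) - \<alpha> k *\<^sub>R dir k \<omega>"
        if "\<omega> \<in> space N" for k \<omega>
        using that by (simp add: N_space recursion)
    qed (fact gradient D_bound D_lipschitz F0 linear_averaging averaging_idem averaging_sym
        linear_consensus_operator averaging_consensus_operator[OF A4(1)]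
        consensus_operator_averaging \<kappa> \<alpha>_le \<beta>_null)+
    show ?thesis
      using N.averaged_gradient_null unfolding A_def[symmetric]
      by (subst (asm) N_integral) auto
  qed
  have bound: "(norm (averaging (D (w k \<omega>))))\<^sup>2 \<le> B\<^sup>2" for k \<omega>
    by (intro power_mono order_trans[OF norm_orthogonal_projection_le[OF averaging_sym averaging_idem] D_bound])
      simp
  have "(\<lambda>k. expectation (\<lambda>\<omega>. (norm (averaging (D (w k \<omega>))))\<^sup>2)) \<longlonglongrightarrow> 0"
    by (rule expectation_null_by_localisation[OF _ _ _ bound localised]) auto
  then show ?thesis
    by (simp add: avg_grad_def averaging_def D_def F_eq)
qed

end
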